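(* The Golomb space $\mathbb{N}_\tau$ is topologically rigid: the only homeomorphism $h:\mathbb{N}_\tau\to\mathbb{N}_\tau$ is the identity map.
   Context: $\mathbb{N}=\{1,2,3,\dots\}$ and $\mathbb{N}_0=\{0\}\cup\mathbb{N}$. The Golomb topology $\tau$ on $\mathbb{N}$ is the topology generated by the base consisting of all arithmetic progressions $a+b\mathbb{N}_0=\{a+bn:n\in\mathbb{N}_0\}$ with $a,b\in\mathbb{N}$ coprime; $\mathbb{N}_\tau=(\mathbb{N},\tau)$ is the Golomb space. A topological space is topologically rigid if its homeomorphism group is trivial. *)

theory Defs
  imports "HOL-Analysis.Analysis" "HOL-Computational_Algebra.Primes"
begin

definition arith_prog :: "nat \<Rightarrow> nat \<Rightarrow> nat set" where
  "arith_prog a b = {a + b * n | n. True}"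

definition golomb_base :: "nat set set" where
  "golomb_base = {arith_prog a b | a b. a \<ge> 1 \<and> b \<ge> 1 \<and> coprime a b}"

text \<open>The Golomb space on N = {1,2,3,...}; its carrier (topspace) is {1..}.\<close>
definition golomb_topology :: "nat topology" where
  "golomb_topology = topology_generated_by golomb_base"

end

theory Submission
  imports "HOL-Number_Theory.Residue_Primitive_Roots" Defs
    "HOL-Computational_Algebra.Polynomial"
begin

text \<open>
  Let \<open>h\<close> be a homeomorphism.  The closures of neighbourhoods of three points show that \<open>h\<close>
  preserves coprimality of distinct numbers, so \<open>h 1 = 1\<close> and there is a permutation \<open>\<sigma>\<close> of the
  primes with \<open>p dvd x\<close> iff \<open>\<sigma> p dvd h x\<close>.  Moreover \<open>h\<close> is continuous from the \<open>l\<close>-adic topology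
  on the numbers prime to \<open>l\<close> to the \<open>\<sigma> l\<close>-adic one.  Since \<open>h\<close> maps the powers of a prime \<open>b\<close> onto the
  powers of \<open>\<sigma> b\<close>, it maps the closed subgroup of \<open>l\<close>-adic units generated by \<open>b\<close> to
  the one of \<open>\<sigma> l\<close>-adic units generated by \<open>\<sigma> b\<close>, and the inclusion order of these subgroups is
  preserved.  For odd \<open>l\<close>, the primes \<open>b\<close> below whose subgroup the order is a chain are exactly
  those congruent to 1 modulo \<open>l\<close>.  The positions in this chain recover the exponent of \<open>l\<close> in
  \<open>x - 1\<close>, which is therefore the exponent of \<open>\<sigma> l\<close> in \<open>h x - 1\<close> (with a slight ambiguity at
  the prime 2).  If \<open>h\<close> fixes all numbers below \<open>x\<close>, then \<open>\<sigma>\<close> fixes the prime factors of \<open>x - 1\<close>,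
  and \<open>h x = x\<close> follows by induction.

  Dirichlet's theorem is replaced by two Euclidean arguments: prime factors of values of cyclotomic
  polynomials yield primes generating \<open>1 + l ^ k \<int>\<^sub>l\<close>, and norms from subfields of cyclotomic
  fields yield primes of prescribed small order modulo \<open>l ^ m\<close>.
\<close>

section \<open>Integer polynomials modulo a cyclotomic polynomial\<close>

text \<open>For odd \<open>l\<close> the \<open>l\<close>-adic units are a cyclic group of order
  \<open>l - 1\<close> times the group of units congruent to 1, whose nontrivial closed subgroups
  form a chain. The closed subgroup generated by a prime not congruent to 1 contains incomparable
  pieces from both factors. At 2 the units are {1, -1} times the units congruent to 1 modulo 4, so
  all odd primes satisfy the chain condition there and the low levels have to be treated apart. The
  obstacle is that \<open>h\<close> is not known to be multiplicative: the exponent in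
  \<open>h (b ^ i) = \<sigma> b ^ j\<close> is out of control. What survives is the inclusion order
  of closed subgroups, and it is accessible only for generators that are prime. So primes must be
  found in prescribed places: of exact level, and close to a nontrivial root of unity. A prime is
  never itself a root of unity, so congruence modulo one high power of \<open>l\<close> has to do.
  The factor lost at 2 leaves \<open>2 * x - 1\<close> as a rival value of \<open>h x\<close>; it is
  refuted by looking at \<open>h (x + 1)\<close>.\<close>

definition ev :: "complex \<Rightarrow> int poly \<Rightarrow> complex" where
  "ev z f = poly (map_poly of_int f) z"

lemma ev_0 [simp]: "ev z 0 = 0"
  by (simp add: ev_def)

lemma ev_pCons [simp]: "ev z (pCons a f) = of_int a + z * ev z f"
  by (simp add: ev_def map_poly_pCons)

lemma ev_1 [simp]: "ev z 1 = 1"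
  by (simp add: one_pCons)

lemma ev_add [simp]: "ev z (f + g) = ev z f + ev z g"
proof -
  have "map_poly complex_of_int (f + g) = map_poly of_int f + map_poly of_int g"
    by (intro poly_eqI) (simp add: coeff_map_poly)
  then show ?thesis by (simp add: ev_def)
qed

lemma ev_smult [simp]: "ev z (Polynomial.smult a f) = of_int a * ev z f"
  by (induction f) (simp_all add: algebra_simps)

lemma ev_uminus [simp]: "ev z (- f) = - ev z f"
  using ev_smult [of z "-1" f] by simp

lemma ev_diff [simp]: "ev z (f - g) = ev z f - ev z g"
  using ev_add [of z f "-g"] by simp

lemma ev_mult [simp]: "ev z (f * g) = ev z f * ev z g"
  by (induction f) (simp_all add: algebra_simps)

lemma ev_prod [simp]: "ev z (prod f A) = (\<Prod>i\<in>A. ev z (f i))"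
  by (induction A rule: infinite_finite_induct) simp_all

lemma ev_monom [simp]: "ev z (monom a k) = of_int a * z ^ k"
  by (simp add: ev_def map_poly_monom poly_monom)

lemma ev_pcompose_monom: "ev z (f \<circ>\<^sub>p monom 1 k) = ev (z ^ k) f"
  by (induction f) (simp_all add: pcompose_pCons)

lemma monic_division:
  fixes f g :: "int poly"
  assumes "lead_coeff g = 1" "degree g > 0"
  obtains q r where "f = g * q + r" "degree r < degree g"
proof -
  obtain q r where qr: "pseudo_divmod f g = (q, r)" by fastforce
  have "g \<noteq> 0" using assms by auto
  from pseudo_divmod [OF this qr] assms show thesis
    by (intro that [of q r]) auto
qed

text \<open>The cyclotomic polynomial of order \<open>l ^ Suc m\<close>.\<close>

definition cyclotomic :: "nat \<Rightarrow> nat \<Rightarrow> int poly" where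
  "cyclotomic l m = (\<Sum>i<l. monom 1 (i * l ^ m))"

lemma cyclotomic_factor: "(monom 1 (l ^ m) - 1) * cyclotomic l m = monom 1 (l ^ Suc m) - 1"
proof -
  have "cyclotomic l m = (\<Sum>i<l. monom 1 (l ^ m) ^ i)"
    by (simp add: cyclotomic_def monom_power mult.commute)
  then show ?thesis
    using power_diff_1_eq [of "monom (1::int) (l ^ m)" l] by (simp add: monom_power mult.commute)
qed

lemma cyclotomic_degree:
  assumes "l > 0"
  shows "degree (cyclotomic l m) = (l - 1) * l ^ m" "lead_coeff (cyclotomic l m) = 1"
proof -
  have c: "coeff (cyclotomic l m) k = (\<Sum>i<l. if i * l ^ m = k then 1 else 0)" for k
    by (simp add: cyclotomic_def coeff_sum)
  have "i * l ^ m = (l - 1) * l ^ m \<longleftrightarrow> i = l - 1" for i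
    using assms by simp
  then have 1: "coeff (cyclotomic l m) ((l - 1) * l ^ m) = 1"
    using assms by (simp add: c)
  moreover have "degree (cyclotomic l m) \<le> (l - 1) * l ^ m"
    unfolding cyclotomic_def
  proof (intro degree_sum_le, goal_cases)
    case (2 i)
    then have "i * l ^ m \<le> (l - 1) * l ^ m" by (intro mult_right_mono) auto
    then show ?case using degree_monom_le order.trans by blast
  qed simp
  ultimately show "degree (cyclotomic l m) = (l - 1) * l ^ m"
    by (intro antisym le_degree) simp_all
  with 1 show "lead_coeff (cyclotomic l m) = 1" by simp
qed

text \<open>Modulo \<open>cyclotomic l m\<close>, exponents may thus be read modulo
  \<open>l ^ Suc m\<close>, as for powers of a root of unity.\<close>

lemma cyclotomic_dvd_monom_diff:
  assumes "[i = j] (mod l ^ Suc m)"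
  shows "cyclotomic l m dvd monom 1 i - monom 1 j"
proof -
  have *: "cyclotomic l m dvd monom 1 i - monom 1 j" if ij: "[i = j] (mod l ^ Suc m)" "i \<le> j" for i j
  proof -
    obtain k where k: "j = i + k * l ^ Suc m"
      using iffD1 [OF cong_le_nat [OF ij(2)] cong_sym [OF ij(1)]] by (metis add.commute)
    have "cyclotomic l m dvd monom 1 (l ^ Suc m) - 1"
      unfolding cyclotomic_factor [symmetric] by simp
    also have "\<dots> dvd monom (1::int) (l ^ Suc m) ^ k - 1"
      unfolding power_diff_1_eq by simp
    finally have "cyclotomic l m dvd monom (1::int) (k * l ^ Suc m) - 1"
      by (simp only: monom_power power_one mult.commute)
    moreover have "monom (1::int) i - monom 1 j = - (monom 1 i * (monom 1 (k * l ^ Suc m) - 1))"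
      by (simp add: k algebra_simps mult_monom)
    ultimately show ?thesis by simp
  qed
  show ?thesis
  proof (cases "i \<le> j")
    case False
    then have "cyclotomic l m dvd monom 1 j - monom 1 i"
      using * [of j i] assms by (simp add: cong_sym_eq)
    then show ?thesis by (metis dvd_minus_iff minus_diff_eq)
  qed (use * assms in blast)
qed

text \<open>Reducing \<open>B\<close> modulo the monic polynomial makes \<open>1 - p * r\<close> a
  multiple of it of smaller degree, hence zero, so \<open>p\<close> would divide 1 by the constant
  coefficients. The ideal generated by \<open>p\<close> and \<open>cyclotomic l m\<close> is
  therefore proper.\<close>

lemma cyclotomic_nonunit_mod:
  assumes "prime l" "prime (p::nat)"
  shows "1 \<noteq> Polynomial.smult (int p) B + cyclotomic l m * C"
proof
  have l: "l > 1" using assms prime_gt_1_nat by blast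
  note c = cyclotomic_degree [of l m]
  assume eq: "1 = Polynomial.smult (int p) B + cyclotomic l m * C"
  obtain q r where qr: "B = cyclotomic l m * q + r" "degree r < degree (cyclotomic l m)"
    using monic_division [of "cyclotomic l m" B] c l by auto
  have "1 - Polynomial.smult (int p) r = cyclotomic l m * (C + Polynomial.smult (int p) q)"
    using eq by (simp add: qr(1) algebra_simps smult_add_right)
  moreover have "degree (1 - Polynomial.smult (int p) r) < degree (cyclotomic l m)"
    by (rule le_less_trans [OF degree_diff_le_max]) (use qr(2) in auto)
  moreover have "cyclotomic l m \<noteq> 0" using c l by auto
  ultimately have "1 - Polynomial.smult (int p) r = 0"
    by (cases "C + Polynomial.smult (int p) q = 0") (simp_all add: degree_mult_eq)
  then have "coeff (1 - Polynomial.smult (int p) r) 0 = 0" by simp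
  then have "1 = int p * coeff r 0" by simp
  then show False
    using assms(2) by (metis dvd_triv_left int_dvd_int_iff not_prime_unit of_nat_1)
qed

lemma ev_cyclotomic:
  fixes \<zeta> :: complex
  assumes l: "prime l" and root: "\<And>i j. \<zeta> ^ i = \<zeta> ^ j \<longleftrightarrow> [i = j] (mod l ^ Suc m)"
    and k: "coprime k l"
  shows "ev (\<zeta> ^ k) (cyclotomic l m) = 0"
proof -
  have "ev (\<zeta> ^ k) ((monom 1 (l ^ m) - 1) * cyclotomic l m) = ev (\<zeta> ^ k) (monom 1 (l ^ Suc m) - 1)"
    by (simp only: cyclotomic_factor)
  then have "((\<zeta> ^ k) ^ (l ^ m) - 1) * ev (\<zeta> ^ k) (cyclotomic l m) = (\<zeta> ^ k) ^ (l ^ Suc m) - 1"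
    by simp
  also have "(\<zeta> ^ k) ^ (l ^ Suc m) = \<zeta> ^ 0"
    unfolding power_mult [symmetric] root by (simp add: cong_0_iff)
  finally have "((\<zeta> ^ k) ^ (l ^ m) - 1) * ev (\<zeta> ^ k) (cyclotomic l m) = 0" by simp
  moreover have "(\<zeta> ^ k) ^ (l ^ m) \<noteq> \<zeta> ^ 0"
  proof
    assume "(\<zeta> ^ k) ^ (l ^ m) = \<zeta> ^ 0"
    then have "l * l ^ m dvd k * l ^ m"
      unfolding power_mult [symmetric] root by (simp add: cong_0_iff)
    then have "l dvd k" using l by (simp add: prime_gt_0_nat)
    with k l show False by (metis coprime_absorb_right not_prime_unit)
  qed
  ultimately show ?thesis by simp
qed

text \<open>The remainder minus its value at \<open>\<zeta>\<close> vanishes at all primitive roots,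
  and there are as many of these as the degree of \<open>cyclotomic l m\<close>. This count stands
  in for Galois theory: an invariant element of Z[\<open>\<zeta>\<close>] is an integer.\<close>

lemma const_mod_cyclotomic:
  fixes \<zeta> :: complex
  assumes l: "prime l" and root: "\<And>i j. \<zeta> ^ i = \<zeta> ^ j \<longleftrightarrow> [i = j] (mod l ^ Suc m)"
    and inv: "\<And>c. coprime c l \<Longrightarrow> ev (\<zeta> ^ c) f = ev \<zeta> f"
  obtains N Q where "f = [:N:] + cyclotomic l m * Q"
proof -
  let ?n = "l ^ Suc m"
  have l1: "l > 1" using l prime_gt_1_nat by blast
  note c = cyclotomic_degree [of l m]
  have dpos: "degree (cyclotomic l m) > 0" using c l1 by simp
  obtain q r where qr: "f = cyclotomic l m * q + r" "degree r < degree (cyclotomic l m)"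
    using monic_division [of "cyclotomic l m" f] c l1 dpos by auto
  note ev0 = ev_cyclotomic [OF l root]
  define R where "R = map_poly complex_of_int r - [:ev \<zeta> r:]"
  have "poly R (\<zeta> ^ k) = 0" if "coprime k l" for k
  proof -
    have "ev (\<zeta> ^ k) f = ev \<zeta> f" by (rule inv) fact
    moreover have "ev \<zeta> (cyclotomic l m) = 0" using ev0 [of 1] by simp
    ultimately show ?thesis using ev0 [OF that] by (simp add: R_def ev_def [symmetric] qr(1))
  qed
  then have sub: "(\<lambda>k. \<zeta> ^ k) ` totatives ?n \<subseteq> {z. poly R z = 0}"
    by (auto simp: totatives_def)
  have "inj_on (\<lambda>k. \<zeta> ^ k) (totatives ?n)"
  proof (intro inj_onI)
    fix i j assume ij: "i \<in> totatives ?n" "j \<in> totatives ?n" "\<zeta> ^ i = \<zeta> ^ j"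
    moreover have "?n > 1" using l1 by (metis one_less_power zero_less_Suc)
    ultimately have "i < ?n" "j < ?n" by (auto simp: totatives_less)
    with ij show "i = j" by (simp add: root cong_less_modulus_unique_nat)
  qed
  then have "card ((\<lambda>k. \<zeta> ^ k) ` totatives ?n) = l ^ m * (l - 1)"
    by (simp only: card_image totient_def [symmetric] totient_prime_power_Suc [OF l])
  then have card: "card ((\<lambda>k. \<zeta> ^ k) ` totatives ?n) = degree (cyclotomic l m)"
    using c l1 by simp
  have "R = 0"
  proof (rule ccontr)
    assume "R \<noteq> 0"
    then have "card ((\<lambda>k. \<zeta> ^ k) ` totatives ?n) \<le> degree R"
      using card_mono [OF poly_roots_finite sub] card_poly_roots_bound [of R] by (meson order.trans)
    also have "degree R \<le> degree r"
      unfolding R_def by (rule degree_diff_le) (simp_all add: map_poly_degree_leq)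
    finally show False using card qr(2) by simp
  qed
  then have "map_poly complex_of_int r = [:ev \<zeta> r:]" by (simp add: R_def)
  then have "degree (map_poly complex_of_int r) = 0" by simp
  then have "degree r = 0" by (simp add: degree_map_poly)
  then obtain N where "r = [:N:]" by (meson degree_eq_zeroE)
  then show thesis using qr(1) that [of N q] by simp
qed

lemma pcompose_monom_monom: "monom (1::int) i \<circ>\<^sub>p monom 1 k = monom 1 (i * k)"
proof (induction i)
  case (Suc i)
  then show ?case by (simp add: monom_Suc pcompose_pCons mult_monom)
qed (simp add: pcompose_1)

section \<open>Frobenius and units modulo a prime\<close>

lemma dvd_power_add:
  fixes u v :: "'a::comm_ring_1"
  assumes "prime p"
  shows "of_nat p dvd (u + v) ^ p - (u ^ p + v ^ p)"
proof -
  have p: "p > 1" using assms prime_gt_1_nat by blast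
  have "(u + v) ^ p = (\<Sum>k\<le>p. of_nat (p choose k) * u ^ k * v ^ (p - k))"
    by (rule binomial_ring)
  also have "\<dots> = (\<Sum>k\<in>{0,p}. of_nat (p choose k) * u ^ k * v ^ (p - k)) +
      (\<Sum>k\<in>{..p} - {0,p}. of_nat (p choose k) * u ^ k * v ^ (p - k))"
    by (subst add.commute, rule sum.subset_diff) auto
  also have "(\<Sum>k\<in>{0,p}. of_nat (p choose k) * u ^ k * v ^ (p - k)) = u ^ p + v ^ p"
    using p by simp
  finally have eq: "(u + v) ^ p - (u ^ p + v ^ p) =
    (\<Sum>k\<in>{..p} - {0,p}. of_nat (p choose k) * u ^ k * v ^ (p - k))" by simp
  show ?thesis unfolding eq
  proof (rule dvd_sum)
    fix k assume "k \<in> {..p} - {0, p}"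
    then have "p dvd (p choose k)" using assms by (intro dvd_choose_prime) auto
    then have "of_nat p dvd (of_nat (p choose k) :: 'a)" by (auto elim!: dvdE)
    then show "of_nat p dvd of_nat (p choose k) * u ^ k * v ^ (p - k)" by simp
  qed
qed

lemma fermat_int:
  assumes "prime p"
  shows "int p dvd a ^ p - a"
proof (cases "int p dvd a")
  case True
  moreover have "p > 0" using assms by (simp add: prime_gt_0_nat)
  ultimately show ?thesis by (intro dvd_diff) (auto intro: dvd_trans [OF _ dvd_power])
next
  case False
  define b where "b = nat (a mod int p)"
  have "p > 0" using assms by (simp add: prime_gt_0_nat)
  then have b: "int b = a mod int p" by (simp add: b_def)
  then have ab: "[a = int b] (mod int p)" by (simp add: cong_def)
  then have "\<not> p dvd b" using False by (metis cong_dvd_iff int_dvd_int_iff cong_sym)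
  then have "[b ^ (p - 1) = 1] (mod p)" using fermat_theorem [OF assms] by simp
  then have "[int b ^ (p - 1) = 1] (mod int p)" by (metis cong_int_iff of_nat_1 of_nat_power)
  with ab have "[a ^ (p - 1) = 1] (mod int p)" by (metis cong_pow cong_trans)
  then have "int p dvd a * (a ^ (p - 1) - 1)"
    by (simp add: cong_iff_dvd_diff)
  moreover have "a * a ^ (p - 1) = a ^ p"
    using \<open>p > 0\<close> by (simp add: power_eq_if)
  ultimately show ?thesis by (simp add: algebra_simps)
qed

text \<open>Additivity of \<open>p\<close>-th powers modulo \<open>p\<close>, with Fermat's theorem
  for the coefficients. It provides the Frobenius map in \<open>norm_prime_factor\<close>.\<close>

lemma frobenius_int_poly:
  fixes f :: "int poly"
  assumes "prime p"
  shows "[:int p:] dvd f ^ p - f \<circ>\<^sub>p monom 1 p"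
proof (induction f)
  case 0
  then show ?case using assms by (simp add: prime_gt_0_nat power_0_left)
next
  case (pCons a f)
  have p: "of_nat p = [:int p:]" by (simp add: of_nat_poly)
  have 1: "pCons a f = [:a:] + monom 1 1 * f" by (simp add: monom_Suc)
  have "[:int p:] dvd ([:a:] + monom 1 1 * f) ^ p - ([:a:] ^ p + (monom 1 1 * f) ^ p)"
    using dvd_power_add [OF assms, of "[:a:]" "monom 1 1 * f"] p by simp
  moreover have "[:int p:] dvd [:a:] ^ p - [:a:]"
    using fermat_int [OF assms, of a] by (simp add: poly_const_pow)
  moreover have "[:int p:] dvd monom 1 p * (f ^ p - f \<circ>\<^sub>p monom 1 p)"
    using pCons by simp
  moreover have "(pCons a f) ^ p - pCons a f \<circ>\<^sub>p monom 1 p =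
      ([:a:] + monom 1 1 * f) ^ p - ([:a:] ^ p + (monom 1 1 * f) ^ p) + ([:a:] ^ p - [:a:])
      + monom 1 p * (f ^ p - f \<circ>\<^sub>p monom 1 p)"
    unfolding 1 [symmetric] by (simp add: pcompose_pCons power_mult_distrib monom_power algebra_simps)
  ultimately show ?case by (metis dvd_add)
qed

lemma prod_cyclic_shift:
  fixes f :: "nat \<Rightarrow> 'a::comm_monoid_mult"
  assumes "f n = f 0" "n > 0"
  shows "(\<Prod>i<n. f (Suc i)) = (\<Prod>i<n. f i)"
proof -
  obtain n' where n: "n = Suc n'" using assms(2) gr0_implies_Suc by blast
  have "(\<Prod>i<n. f (Suc i)) = (\<Prod>i<n'. f (Suc i)) * f 0"
    using assms(1) by (simp add: n)
  then show ?thesis by (simp add: n prod.lessThan_Suc_shift mult.commute del: prod.lessThan_Suc)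
qed

lemma prod_periodic_shift:
  fixes f :: "nat \<Rightarrow> 'a::comm_monoid_mult"
  assumes "\<And>i. f (i + n) = f i" "n > 0"
  shows "(\<Prod>i<n. f (i + k)) = (\<Prod>i<n. f i)"
proof (induction k)
  case (Suc k)
  have "(\<Prod>i<n. f (Suc i + k)) = (\<Prod>i<n. f (i + k))"
    using assms(1) [of k] assms(2) by (intro prod_cyclic_shift) (simp_all add: add.commute)
  with Suc show ?case by simp
qed simp

lemma dvd_prod_diff:
  fixes f g :: "'b \<Rightarrow> 'a::comm_ring_1"
  assumes "\<And>i. i \<in> A \<Longrightarrow> c dvd f i - g i"
  shows "c dvd prod f A - prod g A"
  using assms
proof (induction A rule: infinite_finite_induct)
  case (insert x A)
  have "f x * prod f A - g x * prod g A = f x * (prod f A - prod g A) + (f x - g x) * prod g A"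
    by (simp add: algebra_simps)
  with insert show ?case by simp
qed simp_all

text \<open>Invertibility in Z[X] modulo the ideal generated by \<open>p\<close> and
  \<open>h\<close>, as a Bezout identity instead of in a quotient ring.\<close>

definition unit_mod :: "nat \<Rightarrow> int poly \<Rightarrow> int poly \<Rightarrow> bool" where
  "unit_mod p h f \<longleftrightarrow> (\<exists>A B C. 1 = f * A + [:int p:] * B + h * C)"

lemma unit_mod_1 [simp]: "unit_mod p h 1"
  unfolding unit_mod_def by (rule exI [of _ 1], rule exI [of _ 0], rule exI [of _ 0]) simp

lemma unit_mod_mult:
  assumes "unit_mod p h f" "unit_mod p h g"
  shows "unit_mod p h (f * g)"
proof -
  obtain A B C A' B' C' where 1: "1 = f * A + [:int p:] * B + h * C"
    and 2: "1 = g * A' + [:int p:] * B' + h * C'"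
    using assms unfolding unit_mod_def by blast
  have *: "P + Q + R = 1 \<Longrightarrow> P' + Q' + R' = 1 \<Longrightarrow> 1 = P * P' + (Q + P * Q') + (R + P * R')"
    for P Q R P' Q' R' :: "int poly"
  proof -
    assume 1: "P + Q + R = 1" and 2: "P' + Q' + R' = 1"
    have "1 = P * (P' + Q' + R') + Q + R" using 1 2 by simp
    then show ?thesis by (simp add: algebra_simps)
  qed
  have "1 = f * g * (A * A') + [:int p:] * (B + f * A * B') + h * (C + f * A * C')"
    using * [OF 1 [symmetric] 2 [symmetric]] by (simp only: ring_distribs ac_simps)
  then show ?thesis unfolding unit_mod_def by blast
qed

lemma unit_mod_prod: "(\<And>i. i \<in> I \<Longrightarrow> unit_mod p h (f i)) \<Longrightarrow> unit_mod p h (prod f I)"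
  by (induction I rule: infinite_finite_induct) (simp_all add: unit_mod_mult)

lemma unit_mod_const:
  assumes "coprime c (int p)" and "[:c:] = f * A + [:int p:] * B + h * C"
  shows "unit_mod p h f"
proof -
  obtain u v where "u * c + v * int p = 1"
    using assms(1) bezout_int [of c "int p"] by auto
  then have "1 = [:u:] * [:c:] + [:int p:] * [:v:]"
    by (simp add: one_pCons mult.commute)
  also have "\<dots> = f * ([:u:] * A) + [:int p:] * ([:u:] * B + [:v:]) + h * ([:u:] * C)"
    unfolding assms(2) by (simp only: ring_distribs ac_simps)
  finally show ?thesis unfolding unit_mod_def by blast
qed

text \<open>Being prime to \<open>l\<close> settles coprimality with the \<open>l\<close>-part of
  \<open>M\<close>; the remaining factor is prime to \<open>l\<close>, so the Chinese remainder
  theorem applies to it.\<close>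

lemma ex_coprime_in_class:
  fixes l g :: nat and M :: int
  assumes l: "prime l" and "coprime g l" "M \<noteq> 0"
  obtains a :: nat where "a > 0" "[a = g] (mod l)" "coprime (int a) M"
proof -
  have "nat \<bar>M\<bar> \<noteq> 0" using assms by simp
  moreover have "\<not> is_unit l" using l not_prime_unit by blast
  ultimately obtain M1 where M1: "nat \<bar>M\<bar> = l ^ multiplicity l (nat \<bar>M\<bar>) * M1" "\<not> l dvd M1"
    using multiplicity_decompose' by metis
  then have "coprime l M1" using l by (simp add: prime_imp_coprime)
  then obtain a where a: "[a = g] (mod l)" "[a = 1] (mod M1)"
    using binary_chinese_remainder_nat by blast
  have "coprime a l"
    using a(1) assms(2) by (metis cong_imp_coprime cong_sym)
  moreover have "coprime a M1" using a(2) by (metis cong_imp_coprime cong_sym coprime_1_left)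
  ultimately have "coprime a (nat \<bar>M\<bar>)" by (subst M1(1)) simp
  then have "coprime (int a) M"
    by (metis coprime_int_iff coprime_abs_right_iff int_nat_eq abs_ge_zero)
  moreover have "a > 0" using \<open>coprime a l\<close> l not_prime_unit by (intro gr0I) auto
  ultimately show thesis using a(1) that by blast
qed

section \<open>Primes of prescribed order modulo a prime power\<close>

lemma ex_primitive_root_of_unity:
  assumes "n > 0"
  obtains \<zeta> :: complex where "\<And>i j. \<zeta> ^ i = \<zeta> ^ j \<longleftrightarrow> [i = j] (mod n)"
proof -
  define \<zeta> where "\<zeta> = exp (2 * of_real pi * \<i> / of_nat n)"
  have "\<zeta> ^ i = exp (2 * of_real pi * \<i> * of_nat i / of_nat n)" for i
    unfolding \<zeta>_def exp_of_nat_mult [symmetric] by (simp add: mult_ac)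
  then have "\<zeta> ^ i = \<zeta> ^ j \<longleftrightarrow> [i = j] (mod n)" for i j
    using assms by (simp add: complex_root_unity_eq Cong.cong_def)
  then show thesis by (rule that)
qed

lemma primroot_generates:
  fixes N c :: nat
  assumes "N > 1" "residue_primroot N g" "coprime c N"
  obtains k where "[c = g ^ k] (mod N)"
proof -
  have "coprime (c mod N) N" using assms by simp
  moreover from this have "c mod N > 0" using assms(1) by (intro gr0I) auto
  ultimately have "c mod N \<in> totatives N"
    using assms(1) by (simp add: totatives_def coprime_commute less_imp_le)
  then obtain k where "c mod N = g ^ k mod N"
    using residue_primroot_is_generator [OF assms(1,2)] by (auto simp: bij_betw_def)
  then show thesis by (intro that [of k]) (simp add: Cong.cong_def)
qed

text \<open>Read backwards, a number not congruent to 1 has a prime factor not congruent to 1. Both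
  Euclidean constructions of primes end with this.\<close>

lemma cong_1_prod_primes:
  fixes N l :: nat
  assumes "N > 0" "\<And>p. prime p \<Longrightarrow> p dvd N \<Longrightarrow> [p = 1] (mod l)"
  shows "[N = 1] (mod l)"
  using assms
proof (induction N rule: prime_divisors_induct)
  case (factor p x)
  have "[p = 1] (mod l)" using factor.hyps factor.prems by simp
  moreover have "[x = 1] (mod l)" using factor.prems by (intro factor.IH) auto
  ultimately show ?case using cong_mult [of p 1 l x 1] by simp
qed (simp_all)

text \<open>The power \<open>g ^ D\<close> generates the subgroup of order \<open>e\<close> of the
  units modulo \<open>l ^ Suc m\<close>; \<open>D\<close> is its index, and so the degree of the
  subfield that it fixes.\<close>

locale gauss_periods =
  fixes l m g e D :: nat and \<zeta> :: complex
  assumes l: "prime l"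
    and g: "residue_primroot (l ^ Suc m) g"
    and eD: "e * D = totient (l ^ Suc m)"
    and root: "\<zeta> ^ i = \<zeta> ^ j \<longleftrightarrow> [i = j] (mod l ^ Suc m)"
begin

abbreviation n where "n \<equiv> l ^ Suc m"
abbreviation \<Phi> where "\<Phi> \<equiv> cyclotomic l m"

lemma coprime_g: "coprime n g" "coprime g l" "coprime (g ^ k) l"
  and ord_g: "ord n g = e * D" and eD_pos: "e > 0" "D > 0"
proof -
  show 1: "coprime n g" and "ord n g = e * D"
    using g eD by (simp_all add: residue_primroot_def)
  from 1 show "coprime g l" by (simp add: coprime_commute)
  then show "coprime (g ^ k) l" by simp
  have "totient n > 0" using l by (simp add: prime_gt_0_nat)
  then show "e > 0" "D > 0" using eD by (auto intro: gr0I)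
qed

lemma power_g_cong: "[g ^ i = g ^ j] (mod n) \<longleftrightarrow> [i = j] (mod e * D)"
  using order_divides_expdiff [OF coprime_g(1)] ord_g by simp

lemma power_g_generates:
  assumes "coprime c l"
  obtains k where "[c = g ^ k] (mod n)"
proof -
  have "n > 1" using l by (metis one_less_power prime_gt_1_nat zero_less_Suc)
  then show thesis
    using primroot_generates [OF _ g, of c] assms that by (auto simp del: power_Suc)
qed

text \<open>These elements generate the subfield fixed by the subgroup of order \<open>e\<close>.  Unlike for the
  Gaussian periods, which are sums of the same powers of \<open>\<zeta>\<close>, distinctness of the conjugates for
  suitable \<open>w\<close> needs no linear independence: as polynomials in \<open>w\<close> they have different roots.\<close>

definition period :: "int \<Rightarrow> nat \<Rightarrow> int poly" where
  "period w i = (\<Prod>j<e. [:w:] - monom 1 (g ^ (i + D * j)))"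

lemma period_pcompose:
  "period w i \<circ>\<^sub>p monom 1 k = (\<Prod>j<e. [:w:] - monom 1 (g ^ (i + D * j) * k))"
  by (simp add: period_def pcompose_prod pcompose_diff pcompose_monom_monom)

lemma period_pcompose_g: "period w i \<circ>\<^sub>p monom 1 (g ^ k) = period w (i + k)"
  unfolding period_pcompose unfolding period_def by (simp add: power_add [symmetric] ac_simps)

lemma period_add_D: "\<Phi> dvd period w (i + D) - period w i"
proof -
  let ?f = "\<lambda>j. [:w:] - monom 1 (g ^ (i + D * j)) :: int poly"
  \<comment> \<open>The factors \<open>?f\<close> close up to a cycle only modulo
    \<open>\<Phi>\<close>; replacing the one at \<open>e\<close> by the one at 0 makes the cycle
    exact.\<close>
  define f' where "f' j = (if j = e then ?f 0 else ?f j)" for j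
  have "\<Phi> dvd (\<Prod>j<e. ?f (Suc j)) - (\<Prod>j<e. f' (Suc j))"
  proof (rule dvd_prod_diff)
    fix j assume "j \<in> {..<e}"
    have "[i + D * e = i] (mod e * D)" by (simp add: Cong.cong_def mult.commute)
    then have "\<Phi> dvd monom 1 (g ^ (i + D * 0)) - monom 1 (g ^ (i + D * e))"
      by (intro cyclotomic_dvd_monom_diff) (simp only: power_g_cong cong_sym_eq mult_0_right add_0_right)
    then show "\<Phi> dvd ?f (Suc j) - f' (Suc j)"
      by (auto simp: f'_def)
  qed
  also have "(\<Prod>j<e. f' (Suc j)) = (\<Prod>j<e. f' j)"
    using eD_pos by (intro prod_cyclic_shift) (simp_all add: f'_def)
  also have "\<dots> = period w i"
    unfolding period_def by (intro prod.cong) (auto simp: f'_def)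
  also have "(\<Prod>j<e. ?f (Suc j)) = period w (i + D)"
    by (simp add: period_def add_ac)
  finally show ?thesis .
qed

lemma period_mod: "\<Phi> dvd period w (i + k) - period w (i + k mod D)"
proof -
  have "\<Phi> dvd period w (j + D * q) - period w j" for j q
  proof (induction q)
    case (Suc q)
    have "period w (j + D * Suc q) - period w j =
      (period w (j + D * q + D) - period w (j + D * q)) + (period w (j + D * q) - period w j)"
      by (simp add: add_ac)
    then show ?case using period_add_D Suc by (metis dvd_add)
  qed simp
  from this [of "i + k mod D" "k div D"] show ?thesis by (simp add: add_ac)
qed

lemma ev_\<Phi>: "ev \<zeta> \<Phi> = 0"
  using ev_cyclotomic [OF l root, of 1] by simp

lemma ev_cong: "\<Phi> dvd f - h \<Longrightarrow> ev \<zeta> f = ev \<zeta> h"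
  by (metis dvdE ev_\<Phi> ev_diff ev_mult eq_iff_diff_eq_0 mult_zero_left)

lemma galois_invariant_const:
  assumes "\<And>k. ev \<zeta> (f \<circ>\<^sub>p monom 1 (g ^ k)) = ev \<zeta> f"
  obtains N Q where "f = [:N:] + \<Phi> * Q"
proof (rule const_mod_cyclotomic [OF l root])
  fix c assume c: "coprime c l"
  obtain k where "[c = g ^ k] (mod n)"
    using power_g_generates [OF c] by blast
  then have "\<zeta> ^ c = \<zeta> ^ (g ^ k)" by (simp only: root)
  then show "ev (\<zeta> ^ c) f = ev \<zeta> f"
    using assms [of k] by (simp add: ev_pcompose_monom)
qed

text \<open>A function \<open>F\<close> of two periods covers both uses: differences of periods in
  the discriminant, and the factors of a norm, where the second argument is ignored.\<close>

lemma ev_period_shift: "(\<Prod>i<D. F (ev \<zeta> (period w (i + k))) (ev \<zeta> (period w (i + j + k)))) =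
    (\<Prod>i<D. F (ev \<zeta> (period w i)) (ev \<zeta> (period w (i + j))))"
proof -
  have *: "ev \<zeta> (period w (i + D)) = ev \<zeta> (period w i)" for i
    by (rule ev_cong) (rule period_add_D)
  define f where "f i = F (ev \<zeta> (period w i)) (ev \<zeta> (period w (i + j)))" for i
  have "f (i + D) = f i" for i
    unfolding f_def using * [of i] * [of "i + j"] by (simp add: ac_simps)
  then have "(\<Prod>i<D. f (i + k)) = (\<Prod>i<D. f i)"
    by (intro prod_periodic_shift eD_pos)
  then show ?thesis by (simp add: f_def ac_simps)
qed

lemma ex_separating:
  obtains w :: int where "\<And>i k. \<lbrakk>i < D; 0 < k; k < D\<rbrakk> \<Longrightarrow> ev \<zeta> (period w i) \<noteq> ev \<zeta> (period w (i + k))"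
proof -
  define P where "P i = (\<Prod>j<e. [:- (\<zeta> ^ (g ^ (i + D * j))), 1:])" for i
  have ev: "ev \<zeta> (period w i) = poly (P i) (of_int w)" for w i
    by (simp add: period_def P_def poly_prod)
  have neq: "P i - P (i + k) \<noteq> 0" if "0 < k" "k < D" for i k
  proof
    assume "P i - P (i + k) = 0"
    moreover have "poly (P i) (\<zeta> ^ (g ^ i)) = 0"
      using eD_pos by (force simp: P_def poly_prod intro!: bexI [of _ 0])
    ultimately have "poly (P (i + k)) (\<zeta> ^ (g ^ i)) = 0" by simp
    then obtain j where "\<zeta> ^ (g ^ i) = \<zeta> ^ (g ^ (i + k + D * j))"
      by (auto simp: P_def poly_prod)
    then have "[i = i + (k + D * j)] (mod e * D)"
      by (simp only: root power_g_cong add.assoc)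
    then have "e * D dvd k + D * j"
      by (metis cong_add_lcancel_0_nat cong_0_iff cong_sym)
    then have "D dvd k" by (metis dvd_add_left_iff dvd_mult_right dvd_triv_left)
    with that show False by (auto dest: dvd_imp_le)
  qed
  \<comment> \<open>Each difference is a nonzero polynomial in \<open>w\<close>, so some integer
    avoids the finitely many roots of their product.\<close>
  define B where "B = (\<Prod>i<D. \<Prod>k\<in>{0<..<D}. P i - P (i + k))"
  have "B \<noteq> 0" using neq by (simp add: B_def)
  then have "finite {z. poly B z = 0}" by (rule poly_roots_finite)
  moreover have "infinite (range complex_of_int)"
    using finite_imageD [of complex_of_int UNIV] infinite_UNIV_int by (auto simp: inj_on_def)
  ultimately obtain w where "poly B (of_int w) \<noteq> 0"
    by (metis (mono_tags, lifting) finite_subset image_subset_iff mem_Collect_eq)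
  then have "poly (P i - P (i + k)) (of_int w) \<noteq> 0" if "i < D" "0 < k" "k < D" for i k
    using that by (auto simp: B_def poly_prod)
  then show thesis by (intro that [of w]) (simp add: ev)
qed

text \<open>For fixed \<open>k\<close> the product of the differences over all \<open>i\<close> is
  Galois invariant, hence an integer modulo \<open>\<Phi>\<close>, nonzero by the choice of
  \<open>w\<close>. Multiplying over \<open>k\<close> gives one integer that every difference
  divides modulo \<open>\<Phi>\<close>.\<close>

lemma ex_discriminant:
  shows "\<exists>w \<mu>. \<mu> \<noteq> 0 \<and> (\<forall>i k. i < D \<longrightarrow> 0 < k \<longrightarrow> k < D \<longrightarrow>
    (\<exists>A B. [:\<mu>:] = (period w i - period w (i + k)) * A + \<Phi> * B))"
proof -
  obtain w :: int where w: "\<And>i k. \<lbrakk>i < D; 0 < k; k < D\<rbrakk> \<Longrightarrow> ev \<zeta> (period w i) \<noteq> ev \<zeta> (period w (i + k))"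
    using ex_separating by blast
  have "\<exists>\<mu> Q. (\<Prod>i<D. period w i - period w (i + k)) = [:\<mu>:] + \<Phi> * Q" for k
  proof -
    define f where "f = (\<Prod>i<D. period w i - period w (i + k))"
    have "ev \<zeta> (f \<circ>\<^sub>p monom 1 (g ^ j)) = ev \<zeta> f" for j
      using ev_period_shift [of "(-)" w j k]
      by (simp add: f_def pcompose_prod pcompose_diff period_pcompose_g)
    from galois_invariant_const [OF this] show ?thesis unfolding f_def by metis
  qed
  then obtain \<mu> Q where \<mu>: "\<And>k. (\<Prod>i<D. period w i - period w (i + k)) = [:\<mu> k:] + \<Phi> * Q k"
    by metis
  have nz: "\<mu> k \<noteq> 0" if "0 < k" "k < D" for k
  proof
    assume "\<mu> k = 0"
    then have "(\<Prod>i<D. ev \<zeta> (period w i) - ev \<zeta> (period w (i + k))) = 0"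
      using arg_cong [OF \<mu> [of k], of "ev \<zeta>"] by (simp add: ev_\<Phi>)
    then show False using w that by auto
  qed
  define \<mu>' where "\<mu>' = (\<Prod>k\<in>{0<..<D}. \<mu> k)"
  show ?thesis
  proof (rule exI [of _ w], rule exI [of _ \<mu>'], intro conjI allI impI)
    show "\<mu>' \<noteq> 0" using nz by (simp add: \<mu>'_def)
  next
    fix i k assume ik: "i < D" "0 < k" "k < D"
    then have "\<mu> k dvd \<mu>'" unfolding \<mu>'_def by (intro dvd_prodI) auto
    then obtain c where c: "\<mu>' = \<mu> k * c" by blast
    have "period w i - period w (i + k) dvd (\<Prod>i<D. period w i - period w (i + k))"
      using ik by (intro dvd_prodI) auto
    then obtain A where "(\<Prod>i<D. period w i - period w (i + k)) = (period w i - period w (i + k)) * A"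
      by blast
    then have "[:\<mu> k:] = (period w i - period w (i + k)) * A - \<Phi> * Q k"
      using \<mu> [of k] by (simp add: algebra_simps)
    then have "[:\<mu> k:] * [:c:] = (period w i - period w (i + k)) * (A * [:c:]) + \<Phi> * (- Q k * [:c:])"
      by (simp only: ring_distribs ac_simps diff_conv_add_uminus minus_mult_left minus_mult_right)
    moreover have "[:\<mu>':] = [:\<mu> k:] * [:c:]" by (simp add: c)
    ultimately show "\<exists>A B. [:\<mu>':] = (period w i - period w (i + k)) * A + \<Phi> * B" by metis
  qed
qed

text \<open>Modulo \<open>p\<close>, the \<open>p\<close>-th power of a factor \<open>a - M * period w i\<close> is one of its conjugates.  If this is a
  different conjugate, then the difference of the two, and hence \<open>M * \<mu>\<close>, lies in the ideal
  generated by \<open>p\<close> and the factor.\<close>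

lemma norm_prime_factor:
  fixes a M \<mu> w N :: int
  assumes \<mu>: "\<forall>i k. i < D \<longrightarrow> 0 < k \<longrightarrow> k < D \<longrightarrow>
      (\<exists>A B. [:\<mu>:] = (period w i - period w (i + k)) * A + \<Phi> * B)"
    and "\<mu> dvd M" "coprime a M"
    and N: "(\<Prod>i<D. [:a:] - [:M:] * period w i) = [:N:] + \<Phi> * Q"
    and p: "prime p" "p \<noteq> l" "[p ^ e \<noteq> 1] (mod n)"
  shows "\<not> int p dvd N"
proof
  assume "int p dvd N"
  let ?x = "\<lambda>i. [:a:] - [:M:] * period w i"
  have "coprime p l" using p l primes_coprime by blast
  then obtain k where k: "[p = g ^ k] (mod n)" using power_g_generates by blast
  \<comment> \<open>Otherwise \<open>p\<close> would lie in the subgroup of order \<open>e\<close>.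
    As it does not, \<open>p\<close>-th powers move each period to a different conjugate.\<close>
  have "\<not> D dvd k"
  proof
    assume "D dvd k"
    then have "[k * e = 0] (mod e * D)" by (auto simp: cong_0_iff mult.commute)
    then have "[g ^ (k * e) = 1] (mod n)" using power_g_cong [of "k * e" 0] by simp
    then show False using p(3) cong_pow [OF k, of e] by (metis cong_trans power_mult)
  qed
  then have kD: "0 < k mod D" "k mod D < D" using eD_pos by (auto simp: dvd_eq_mod_eq_0)
  have "unit_mod p \<Phi> (?x i)" if i: "i < D" for i
  proof (cases "int p dvd M")
    case True
    then obtain M' where M': "M = int p * M'" by blast
    \<comment> \<open>Here the factor is \<open>a\<close> modulo \<open>p\<close>, and
      \<open>a\<close> is prime to \<open>M\<close>, hence to \<open>p\<close>.\<close>
    have "coprime a (int p)" using \<open>coprime a M\<close> M' by simp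
    moreover have "[:a:] = ?x i * 1 + [:int p:] * ([:M':] * period w i) + \<Phi> * 0"
      by (simp add: M' mult.commute)
    ultimately show ?thesis by (rule unit_mod_const)
  next
    case False
    obtain B where B: "?x i ^ p = ?x i \<circ>\<^sub>p monom 1 p + [:int p:] * B"
      using frobenius_int_poly [OF p(1), of "?x i"] by (auto elim!: dvdE simp: algebra_simps)
    have "\<Phi> dvd period w i \<circ>\<^sub>p monom 1 p - period w (i + k)"
      unfolding period_pcompose unfolding period_def
    proof (rule dvd_prod_diff)
      fix j
      have "[g ^ (i + D * j) * p = g ^ (i + k + D * j)] (mod n)"
        using cong_scalar_left [OF k, of "g ^ (i + D * j)"] by (simp add: power_add mult_ac del: power_Suc)
      then have "\<Phi> dvd - (monom 1 (g ^ (i + D * j) * p) - monom 1 (g ^ (i + k + D * j)))"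
        unfolding dvd_minus_iff by (rule cyclotomic_dvd_monom_diff)
      then show "\<Phi> dvd [:w:] - monom 1 (g ^ (i + D * j) * p) - ([:w:] - monom 1 (g ^ (i + k + D * j)))"
        by simp
    qed
    moreover have "\<Phi> dvd period w (i + k) - period w (i + k mod D)" by (rule period_mod)
    ultimately have "\<Phi> dvd (period w i \<circ>\<^sub>p monom 1 p - period w (i + k)) + (period w (i + k) - period w (i + k mod D))"
      by (rule dvd_add)
    then obtain C where "(period w i \<circ>\<^sub>p monom 1 p - period w (i + k)) + (period w (i + k) - period w (i + k mod D)) = \<Phi> * C"
      by (elim dvdE)
    then have C: "period w i \<circ>\<^sub>p monom 1 p = period w (i + k mod D) + \<Phi> * C"
      by (simp add: algebra_simps)
    obtain A' B' where AB: "[:\<mu>:] = (period w i - period w (i + k mod D)) * A' + \<Phi> * B'"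
      using \<mu> i kD by blast
    obtain M' where M': "M = \<mu> * M'" using \<open>\<mu> dvd M\<close> by blast
    have xk: "?x i \<circ>\<^sub>p monom 1 p = ?x i + [:M:] * (period w i - period w (i + k mod D)) - [:M:] * (\<Phi> * C)"
      by (simp add: pcompose_diff pcompose_smult C algebra_simps smult_add_right)
    have xp: "?x i ^ p = ?x i * ?x i ^ (p - 1)"
      using p(1) by (simp add: power_eq_if prime_gt_0_nat)
    have *: "K * \<mu>' = X * ((Y - 1) * A) + P * (- Z * A) + F * (K * Cc * A + K * Bb)"
      if "X * Y = X + K * T - K * (F * Cc) + P * Z" "\<mu>' = T * A + F * Bb"
      for K \<mu>' X Y A P Z F Cc Bb T :: "int poly"
    proof -
      have "K * T = X * Y - X + K * (F * Cc) - P * Z" using that(1) by (simp add: algebra_simps)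
      then have "K * T * A + K * F * Bb = (X * Y - X + K * (F * Cc) - P * Z) * A + K * F * Bb" by simp
      then show ?thesis unfolding that(2) by (simp add: algebra_simps)
    qed
    have "[:M * \<mu>:] = [:M:] * [:\<mu>:]" by simp
    also have "\<dots> = ?x i * ((?x i ^ (p - 1) - 1) * A') + [:int p:] * (- B * A') + \<Phi> * ([:M:] * C * A' + [:M:] * B')"
      using B AB unfolding xp xk by (rule *)
    finally have eq: "[:M * \<mu>:] = ?x i * ((?x i ^ (p - 1) - 1) * A') + [:int p:] * (- B * A') + \<Phi> * ([:M:] * C * A' + [:M:] * B')" .
    have "\<not> int p dvd M * \<mu>"
      using False p(1) M' by (simp add: prime_dvd_mult_iff)
    then have "coprime (M * \<mu>) (int p)"
      using p(1) by (metis coprime_commute prime_imp_coprime prime_nat_int_transfer)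
    then show ?thesis using eq by (rule unit_mod_const)
  qed
  \<comment> \<open>The factors would multiply to the unit \<open>N\<close>, whereas
    \<open>p\<close> divides \<open>N\<close> and the ideal generated by \<open>p\<close> and
    \<open>\<Phi>\<close> is proper.\<close>
  then have "unit_mod p \<Phi> (\<Prod>i<D. ?x i)" by (intro unit_mod_prod) auto
  then obtain A B C where "1 = ([:N:] + \<Phi> * Q) * A + [:int p:] * B + \<Phi> * C"
    unfolding unit_mod_def N by blast
  moreover obtain N' where "N = int p * N'" using \<open>int p dvd N\<close> by blast
  then have "[:N:] = [:int p:] * [:N':]" by simp
  ultimately have "1 = [:int p:] * ([:N':] * A + B) + \<Phi> * (Q * A + C)"
    by (simp only: ring_distribs ac_simps)
  then have "1 = Polynomial.smult (int p) ([:N':] * A + B) + \<Phi> * (Q * A + C)" by simp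
  then show False using cyclotomic_nonunit_mod [OF l p(1)] by blast
qed

text \<open>For \<open>e = 2\<close> the power \<open>g ^ D\<close> is -1 modulo \<open>n\<close>,
  so the two factors of a period are complex conjugates and the period is the square of an absolute
  value. This settles the sign of the norm in \<open>ex_prime_in_subgroup\<close>.\<close>

lemma ev_period_nonneg:
  assumes "e = 2" "odd l"
  obtains r where "ev \<zeta> (period w i) = of_real r" "r \<ge> 0"
proof -
  have pos: "g ^ k > 0" for k
    using coprime_g(3) [of k] l not_prime_unit by (intro gr0I) auto
  have dvd_iff: "n dvd g ^ k - 1 \<longleftrightarrow> [k = 0] (mod e * D)" for k
    using cong_altdef_nat [of 1 "g ^ k" n] pos [of k] power_g_cong [of k 0] by auto
  have "\<not> n dvd g ^ D - 1"
    using dvd_iff [of D] assms(1) eD_pos by (auto simp: cong_0_iff dest: dvd_imp_le)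
  have "n dvd g ^ (2 * D) - 1"
    using dvd_iff [of "2 * D"] assms(1) by (auto simp: cong_0_iff)
  also have "g ^ (2 * D) - 1 = (g ^ D - 1) * (g ^ D + 1)"
  proof -
    obtain y where "g ^ D = Suc y" using pos [of D] gr0_implies_Suc by blast
    moreover have "g ^ (2 * D) = g ^ D * g ^ D" by (simp add: mult_2 power_add)
    ultimately show ?thesis by simp
  qed
  finally have dvd: "n dvd (g ^ D - 1) * (g ^ D + 1)" .
  \<comment> \<open>Being odd, \<open>l\<close> divides at most one of the two factors, so its power
    \<open>n\<close> divides one of them entirely.\<close>
  have n: "n dvd g ^ D + 1"
  proof (cases "l dvd g ^ D - 1")
    case True
    have "\<not> l dvd g ^ D + 1"
    proof
      assume "l dvd g ^ D + 1"
      from this True have "l dvd (g ^ D + 1) - (g ^ D - 1)" by (rule dvd_diff_nat)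
      moreover have "(g ^ D + 1) - (g ^ D - 1) = 2"
        using pos [of D] by linarith
      ultimately show False using assms(2) l by (metis dvd_refl primes_dvd_imp_eq two_is_prime_nat)
    qed
    then have "coprime n (g ^ D + 1)" using l by (simp add: prime_imp_coprime)
    with dvd have "n dvd g ^ D - 1" by (metis coprime_dvd_mult_left_iff)
    with \<open>\<not> n dvd g ^ D - 1\<close> show ?thesis by blast
  next
    case False
    then have "coprime n (g ^ D - 1)" using l by (simp add: prime_imp_coprime)
    with dvd show ?thesis by (metis coprime_dvd_mult_right_iff)
  qed
  have norm1: "norm \<zeta> = 1"
  proof -
    have "\<zeta> ^ n = \<zeta> ^ 0" by (simp only: root) (simp add: cong_0_iff)
    then have "norm (\<zeta> ^ n) = 1" by simp
    then have "norm \<zeta> ^ n = 1" by (simp only: norm_power)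
    moreover have "n > 0" using l by (simp add: prime_gt_0_nat)
    ultimately show ?thesis using power_eq_imp_eq_base [of "norm \<zeta>" n 1] by simp
  qed
  let ?z = "\<zeta> ^ (g ^ i)"
  have "n dvd g ^ i * (g ^ D + 1)" using n by (rule dvd_mult)
  moreover have "g ^ i * (g ^ D + 1) = g ^ i + g ^ (i + D)" by (simp add: power_add)
  ultimately have "[g ^ i + g ^ (i + D) = 0] (mod n)" by (simp only: cong_0_iff)
  then have "\<zeta> ^ (g ^ i + g ^ (i + D)) = \<zeta> ^ 0" by (simp only: root)
  then have "?z * \<zeta> ^ (g ^ (i + D)) = 1" by (simp add: power_add)
  moreover have "?z * cnj ?z = 1"
    using complex_norm_square [of ?z] norm1 by (simp add: norm_power)
  moreover have "?z \<noteq> 0" using norm1 by auto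
  ultimately have cnj: "\<zeta> ^ (g ^ (i + D)) = cnj ?z" by (metis mult_left_cancel)
  have "{..<e} = {0, 1}" using assms by auto
  then have "ev \<zeta> (period w i) = (of_int w - ?z) * (of_int w - \<zeta> ^ (g ^ (i + D)))"
    by (simp add: period_def)
  also have "\<dots> = (of_int w - ?z) * cnj (of_int w - ?z)" by (simp add: cnj)
  also have "\<dots> = of_real ((norm (of_int w - ?z))\<^sup>2)"
    by (simp only: complex_norm_square)
  finally show thesis by (rule that) simp
qed

end

text \<open>The norm \<open>N\<close> of \<open>a - M * period\<close> is \<open>a ^ D\<close>
  modulo \<open>l\<close>, with \<open>a\<close> a primitive root modulo \<open>l\<close>. So
  \<open>N\<close> is not 1 modulo \<open>l\<close>, nor, after a look at signs, is its absolute
  value, and some prime factor is not 1 modulo \<open>l\<close> either. By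
  \<open>norm_prime_factor\<close> this prime can only have \<open>p ^ e\<close> congruent to
  1.\<close>

theorem ex_prime_in_subgroup:
  assumes l: "prime (l::nat)" "odd l" and e: "e dvd l - 1" "e > 1"
  obtains p where "prime p" "[p ^ e = 1] (mod l ^ Suc m)" "[p \<noteq> 1] (mod l)"
proof -
  obtain g where gk: "\<forall>k>0. residue_primroot (l ^ k) g"
    using residue_primroot_odd_prime_power_exists [OF l] by blast
  have g: "residue_primroot (l ^ Suc m) g" using gk by blast
  have gl: "residue_primroot l g" using spec [OF gk, of 1] by simp
  have tot: "totient (l ^ Suc m) = l ^ m * (l - 1)" using totient_prime_power_Suc [OF l(1)] .
  from e obtain e' where e': "l - 1 = e * e'" by blast
  define D where "D = l ^ m * e'"
  have eD: "e * D = totient (l ^ Suc m)" unfolding tot D_def e' by simp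
  have l0: "l > 0" "l > 1" using l prime_gt_1_nat prime_gt_0_nat by auto
  then have "l ^ Suc m > 0" by simp
  then obtain \<zeta> :: complex where root: "\<And>i j. \<zeta> ^ i = \<zeta> ^ j \<longleftrightarrow> [i = j] (mod l ^ Suc m)"
    using ex_primitive_root_of_unity by metis
  note odd_l = l(2)
  interpret gauss_periods l m g e D \<zeta>
    by unfold_locales (fact l(1) g eD root)+
  obtain w \<mu> where \<mu>: "\<mu> \<noteq> 0" "\<forall>i k. i < D \<longrightarrow> 0 < k \<longrightarrow> k < D \<longrightarrow>
    (\<exists>A B. [:\<mu>:] = (period w i - period w (i + k)) * A + \<Phi> * B)"
    using ex_discriminant by metis
  \<comment> \<open>The factor \<open>l\<close> makes the norm congruent to \<open>a ^ D\<close>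
    modulo \<open>l\<close>, the factor \<open>\<mu>\<close> is what
    \<open>norm_prime_factor\<close> asks for, and the minus sign makes all factors of the norm
    positive when the periods are nonnegative.\<close>
  define M where "M = - (int l * \<bar>\<mu>\<bar>)"
  have M: "M \<noteq> 0" "\<mu> dvd M" "M \<le> 0" "int l dvd M" using \<mu>(1) l0 by (simp_all add: M_def)
  obtain a :: nat where a: "a > 0" "[a = g] (mod l)" "coprime (int a) M"
    using ex_coprime_in_class [OF l(1) coprime_g(2) M(1)] by blast
  define \<Gamma> where "\<Gamma> = (\<Prod>i<D. [:int a:] - [:M:] * period w i)"
  have "ev \<zeta> (\<Gamma> \<circ>\<^sub>p monom 1 (g ^ k)) = ev \<zeta> \<Gamma>" for k
    using ev_period_shift [of "\<lambda>u v. of_nat a - of_int M * u" w k 0]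
    by (simp add: \<Gamma>_def pcompose_prod pcompose_diff pcompose_smult period_pcompose_g)
  then obtain N Q where N: "\<Gamma> = [:N:] + \<Phi> * Q" using galois_invariant_const by blast
  have Nl: "[N = int a ^ D] (mod int l)"
  proof -
    obtain M' where M': "M = int l * M'" using M(4) by blast
    have "poly \<Phi> 1 = int l" by (simp add: cyclotomic_def poly_sum poly_monom)
    then have "poly \<Gamma> 1 = N + int l * poly Q 1" by (simp add: N)
    then have "[N = poly \<Gamma> 1] (mod int l)" by (simp add: cong_iff_dvd_diff)
    also have "poly \<Gamma> 1 = (\<Prod>i<D. int a - M * poly (period w i) 1)"
      by (simp add: \<Gamma>_def poly_prod)
    also have "[\<dots> = (\<Prod>i<D. int a)] (mod int l)"
      by (intro cong_prod) (simp add: M' cong_iff_dvd_diff)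
    finally show ?thesis by simp
  qed
  have al: "coprime a l" using cong_imp_coprime [OF cong_sym [OF a(2)] coprime_g(2)] .
  have ordl: "ord l a = l - 1"
  proof -
    have "ord l a = ord l g" using a(2) by (rule ord_cong)
    then show ?thesis using gl l by (simp add: residue_primroot_def totient_prime)
  qed
  have "\<not> l dvd a" using al l by (auto simp: coprime_absorb_right)
  then have "\<not> int l dvd int a ^ D"
    using l by (simp add: prime_dvd_power_iff eD_pos)
  then have "\<not> int l dvd N" using Nl by (simp add: cong_dvd_iff)
  then have "N \<noteq> 0" by auto
  have coe: "coprime e (l ^ m)"
  proof -
    have "coprime (l - 1) l" using coprime_diff_one_left_nat [of l] l0 by blast
    then have "coprime e l" using coprime_divisors [OF e(1) dvd_refl] by blast
    then show ?thesis by simp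
  qed
  \<comment> \<open>Cancelling \<open>e'\<close> leaves \<open>e dvd c * l ^ m\<close>, and
    \<open>e\<close> is prime to \<open>l\<close>.\<close>
  have D2: "e dvd c" if "(l - 1) dvd c * D" for c
  proof -
    have "e * e' dvd c * l ^ m * e'" using that unfolding D_def e' by (simp only: mult.assoc)
    moreover have "e' \<noteq> 0" using eD_pos by (auto simp: D_def)
    ultimately have "e dvd c * l ^ m" by simp
    then show ?thesis using coe by (simp add: coprime_dvd_mult_left_iff)
  qed
  have no1: "[int a ^ D \<noteq> 1] (mod int l)"
  proof
    assume "[int a ^ D = 1] (mod int l)"
    then have "[int (a ^ D) = int 1] (mod int l)" by simp
    then have "[a ^ D = 1] (mod l)" by (simp only: cong_int_iff)
    then have "l - 1 dvd 1 * D" using ord_divides [of a D l] ordl by simp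
    then have "e dvd 1" by (rule D2)
    then show False using e(2) by simp
  qed
  have "[int (nat \<bar>N\<bar>) \<noteq> 1] (mod int l)"
  proof (cases "N > 0")
    case True
    show ?thesis
    proof
      assume "[int (nat \<bar>N\<bar>) = 1] (mod int l)"
      with True have "[N = 1] (mod int l)" by simp
      then show False using no1 cong_trans [OF cong_sym [OF Nl]] by blast
    qed
  next
    case False
    show ?thesis
    proof
      assume "[int (nat \<bar>N\<bar>) = 1] (mod int l)"
      \<comment> \<open>A negative norm could do harm only if \<open>a ^ D\<close> is -1 modulo
        \<open>l\<close>. This forces \<open>e = 2\<close>, where the norm is a product of positive
        reals.\<close>
      with False have "[- N = 1] (mod int l)" by simp
      then have "[N = -1] (mod int l)" using cong_minus_minus_iff [of "- N" 1] by simp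
      then have "[int a ^ D = -1] (mod int l)" using cong_trans [OF cong_sym [OF Nl]] by blast
      then have "[(int a ^ D)\<^sup>2 = (-1)\<^sup>2] (mod int l)" by (rule cong_pow)
      then have "[int (a ^ (2 * D)) = int 1] (mod int l)" by (simp add: power_mult [symmetric] mult.commute)
      then have "[a ^ (2 * D) = 1] (mod l)" by (simp only: cong_int_iff)
      then have "l - 1 dvd 2 * D" by (simp only: ord_divides ordl)
      then have "e = 2" using D2 [of 2] e(2) by (auto dest: dvd_imp_le)
      have "\<exists>r\<ge>0. ev \<zeta> (period w i) = of_real r" for i
        using ev_period_nonneg [OF \<open>e = 2\<close> odd_l] by metis
      then obtain r where r: "\<And>i. ev \<zeta> (period w i) = of_real (r i)" "\<And>i. r i \<ge> 0"
        by metis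
      have "ev \<zeta> \<Gamma> = of_int N" by (simp add: N ev_\<Phi>)
      then have "of_real (of_int N) = (\<Prod>i<D. complex_of_real (real a - of_int M * r i))"
        by (simp add: \<Gamma>_def r)
      then have "of_int N = (\<Prod>i<D. real a - of_int M * r i)"
        unfolding of_real_prod [symmetric] by (simp only: of_real_eq_iff)
      moreover have "(\<Prod>i<D. real a - of_int M * r i) > 0"
      proof (intro prod_pos)
        fix i
        have "of_int M * r i \<le> 0" using M(3) r(2) [of i] by (simp add: mult_le_0_iff)
        then show "real a - of_int M * r i > 0" using a(1) by linarith
      qed
      ultimately show False using False by linarith
    qed
  qed
  then have "[nat \<bar>N\<bar> \<noteq> 1] (mod l)" using cong_int_iff [of "nat \<bar>N\<bar>" 1 l] by simp
  then obtain p where p: "prime p" "p dvd nat \<bar>N\<bar>" "[p \<noteq> 1] (mod l)"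
    using cong_1_prod_primes [of "nat \<bar>N\<bar>" l] \<open>N \<noteq> 0\<close> by auto
  then have pN: "int p dvd N" using int_dvd_int_iff [of p "nat \<bar>N\<bar>"] by simp
  then have "p \<noteq> l" using \<open>\<not> int l dvd N\<close> by blast
  then have "[p ^ e = 1] (mod l ^ Suc m)"
    using norm_prime_factor [OF \<mu>(2) M(2) a(3) N [unfolded \<Gamma>_def] p(1)] pN by blast
  then show thesis using p by (intro that)
qed

section \<open>Closures of sets of powers in the \<open>l\<close>-adic units\<close>

text \<open>The exponent of \<open>l\<close> in \<open>s - 1\<close> is exactly \<open>k\<close>.
  For positive \<open>k\<close>, at least 2 when \<open>l = 2\<close>, such an \<open>s\<close>
  topologically generates the group of all \<open>l\<close>-adic units congruent to 1 modulo
  \<open>l ^ k\<close>.\<close>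

definition level :: "nat \<Rightarrow> nat \<Rightarrow> nat \<Rightarrow> bool" where
  "level l k s \<longleftrightarrow> [s = 1] (mod l ^ k) \<and> [s \<noteq> 1] (mod l ^ Suc k)"

lemma level_iff:
  assumes "prime l" "k > 0"
  shows "level l k s \<longleftrightarrow> (\<exists>u. s = 1 + l ^ k * u \<and> \<not> l dvd u)"
proof
  assume s: "level l k s"
  have "s \<noteq> 0"
  proof
    assume "s = 0"
    then have "l ^ k dvd 1" using s unfolding level_def by (metis cong_0_iff cong_sym)
    then show False using assms by (simp add: prime_gt_1_nat prime_nat_iff)
  qed
  then obtain u where u: "s = 1 + l ^ k * u"
    using s unfolding level_def by (metis cong_le_nat One_nat_def Suc_leI add.commute gr0I mult.commute)
  have "\<not> l dvd u"
  proof
    assume "l dvd u"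
    then have "[s = 1 + 0] (mod l ^ Suc k)"
      unfolding u by (intro cong_add) (auto simp: cong_0_iff)
    then show False using s by (simp add: level_def)
  qed
  with u show "\<exists>u. s = 1 + l ^ k * u \<and> \<not> l dvd u" by blast
next
  assume "\<exists>u. s = 1 + l ^ k * u \<and> \<not> l dvd u"
  then obtain u where u: "s = 1 + l ^ k * u" "\<not> l dvd u" by blast
  have "[1 + l ^ k * u = 1 + 0] (mod l ^ k)" by (intro cong_add) (auto simp: cong_0_iff)
  moreover have "\<not> [1 + l ^ k * u = 1 + 0] (mod l ^ Suc k)"
    unfolding cong_add_lcancel_nat cong_0_iff using u(2) assms by (simp add: prime_gt_0_nat)
  ultimately show "level l k s" by (simp add: level_def u(1))
qed

text \<open>A remainder of order three is enough: \<open>l ^ (3 * k)\<close> is divisible by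
  \<open>l ^ (k + 2)\<close> for positive \<open>k\<close>, whereas for \<open>k = 1\<close> the
  quadratic term needs the factor \<open>l\<close> of \<open>l choose 2\<close>.\<close>

lemma one_plus_power:
  "\<exists>r. (1 + y) ^ n = 1 + n * y + (n choose 2) * y\<^sup>2 + y ^ 3 * (r::nat)"
proof (induction n)
  case (Suc n)
  then obtain r where "(1 + y) ^ n = 1 + n * y + (n choose 2) * y\<^sup>2 + y ^ 3 * r" by blast
  then have "(1 + y) ^ Suc n = 1 + Suc n * y + (n + (n choose 2)) * y\<^sup>2 + y ^ 3 * (r + (n choose 2) + y * r)"
    by (simp add: algebra_simps power2_eq_square power3_eq_cube)
  moreover have "Suc n choose 2 = n + (n choose 2)"
    by (simp add: numeral_2_eq_2)
  ultimately show ?case by metis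
qed simp

lemma level_power_prime:
  assumes l: "prime l" and k: "k > 0" "l = 2 \<Longrightarrow> k \<ge> 2" and s: "level l k s"
  shows "level l (Suc k) (s ^ l)"
proof -
  obtain u where u: "s = 1 + l ^ k * u" "\<not> l dvd u" using s level_iff [OF l k(1)] by blast
  obtain r where r: "s ^ l = 1 + l * (l ^ k * u) + (l choose 2) * (l ^ k * u)\<^sup>2 + (l ^ k * u) ^ 3 * r"
    using one_plus_power [of "l ^ k * u" l] u(1) by auto
  have "l ^ Suc (Suc k) dvd (l choose 2) * (l ^ k * u)\<^sup>2"
  proof (cases "l = 2")
    case True
    \<comment> \<open>Now \<open>l choose 2\<close> is 1, so \<open>k + 2 \<le> 2 * k\<close> is
      required. Level 1 indeed fails: 3 has level 1, but 9 has level 3.\<close>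
    then have "l ^ Suc (Suc k) dvd l ^ (2 * k)" using k by (intro le_imp_power_dvd) auto
    then show ?thesis by (simp add: power_mult_distrib power_mult [symmetric] mult.commute [of 2] del: power_Suc)
  next
    case False
    then have "l > 2" using prime_ge_2_nat [OF l] by simp
    then have "l dvd (l choose 2)" using l by (intro dvd_choose_prime) auto
    moreover have "l ^ Suc k dvd l ^ (2 * k)" using k by (intro le_imp_power_dvd) auto
    ultimately have "l * l ^ Suc k dvd (l choose 2) * l ^ (2 * k)" by (rule mult_dvd_mono)
    then show ?thesis
      by (simp add: power_mult_distrib power_mult [symmetric] mult.commute [of 2] flip: mult.assoc)
  qed
  moreover have "l ^ Suc (Suc k) dvd (l ^ k * u) ^ 3 * r"
  proof -
    have "l ^ Suc (Suc k) dvd l ^ (3 * k)" using k by (intro le_imp_power_dvd) auto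
    then show ?thesis by (simp add: power_mult_distrib power_mult [symmetric] mult.commute [of 3] del: power_Suc)
  qed
  ultimately have "l ^ Suc (Suc k) dvd (l choose 2) * (l ^ k * u)\<^sup>2 + (l ^ k * u) ^ 3 * r" by (rule dvd_add)
  then obtain t where "(l choose 2) * (l ^ k * u)\<^sup>2 + (l ^ k * u) ^ 3 * r = l ^ Suc (Suc k) * t" by (elim dvdE)
  then have "s ^ l = 1 + l ^ Suc k * (u + l * t)" unfolding r by (simp add: algebra_simps)
  moreover have "\<not> l dvd u + l * t" using u(2) by (simp add: dvd_add_left_iff)
  ultimately show ?thesis using level_iff [OF l] by blast
qed

lemma level_power_prime_power:
  assumes "prime l" "k > 0" "l = 2 \<Longrightarrow> k \<ge> 2" "level l k s"
  shows "level l (k + j) (s ^ (l ^ j))"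
proof (induction j)
  case (Suc j)
  have "level l (Suc (k + j)) ((s ^ l ^ j) ^ l)"
    using assms by (intro level_power_prime Suc) auto
  then show ?case by (simp add: power_mult [symmetric] mult.commute)
qed (simp add: assms)

lemma level_power_coprime:
  assumes l: "prime l" and k: "k > 0" and s: "level l k s" and t: "\<not> l dvd t"
  shows "level l k (s ^ t)"
proof -
  obtain u where u: "s = 1 + l ^ k * u" "\<not> l dvd u" using s level_iff [OF l k] by blast
  obtain r where r: "s ^ t = 1 + t * (l ^ k * u) + (t choose 2) * (l ^ k * u)\<^sup>2 + (l ^ k * u) ^ 3 * r"
    using one_plus_power [of "l ^ k * u" t] u(1) by auto
  obtain k' where k': "k = Suc k'" using k gr0_implies_Suc by blast
  have "s ^ t = 1 + l ^ k * (t * u + l * (l ^ k' * (u * u * (t choose 2) + l ^ k * u ^ 3 * r)))"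
    unfolding r k' by (simp add: algebra_simps power2_eq_square power3_eq_cube)
  moreover have "\<not> l dvd t * u + l * x" for x
    using u(2) t l by (simp add: dvd_add_left_iff prime_dvd_mult_iff)
  ultimately show ?thesis using level_iff [OF l k] by blast
qed

text \<open>\<open>x\<close> lies in the \<open>l\<close>-adic closure of the set of powers of \<open>b\<close>, which for \<open>b\<close> prime to \<open>l\<close> is
  the closed subgroup generated by \<open>b\<close>.\<close>

definition power_closure :: "nat \<Rightarrow> nat \<Rightarrow> nat \<Rightarrow> bool" where
  "power_closure l b x \<longleftrightarrow> (\<forall>m. \<exists>i\<ge>1. [x = b ^ i] (mod l ^ m))"

lemma cong_prime_power_le: "[x = y] (mod (l::nat) ^ m) \<Longrightarrow> j \<le> m \<Longrightarrow> [x = y] (mod l ^ j)"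
  by (rule cong_dvd_modulus_nat) (auto intro: le_imp_power_dvd)

text \<open>Digit by digit: \<open>s ^ (l ^ j)\<close> has level \<open>k + j\<close>, so a suitable
  power of it corrects the next \<open>l\<close>-adic digit of \<open>s ^ i\<close>.\<close>

lemma level_power_approximation:
  assumes l: "prime l" and k: "k > 0" "l = 2 \<Longrightarrow> k \<ge> 2" and s: "level l k s"
    and x: "[x = 1] (mod l ^ k)"
  shows "\<exists>i\<ge>1. [x = s ^ i] (mod l ^ (k + j))"
proof (induction j)
  case 0
  have "[x = s ^ 1] (mod l ^ (k + 0))"
    using x s by (auto simp: level_def intro: cong_trans cong_sym)
  then show ?case by blast
next
  case (Suc j)
  then obtain i where i: "i \<ge> 1" "[x = s ^ i] (mod l ^ (k + j))" by blast
  define L where "L = int (l ^ (k + j))"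
  have "[int x = int (s ^ i)] (mod L)" using i(2) by (simp only: L_def cong_int_iff)
  then obtain v where v: "int x = int (s ^ i) + L * v"
    by (metis cong_iff_lin cong_sym)
  obtain u where u: "s ^ (l ^ j) = 1 + l ^ (k + j) * u" "\<not> l dvd u"
    using level_power_prime_power [OF l k s] level_iff [OF l, of "k + j"] k by auto
  have "\<not> l dvd s"
  proof
    assume "l dvd s"
    moreover have "l dvd l ^ k" using k by (simp add: dvd_power)
    then have "[s = 1] (mod l)" using s unfolding level_def by (metis cong_dvd_modulus_nat)
    ultimately show False using l by (metis cong_dvd_iff not_prime_unit)
  qed
  then have "\<not> l dvd s ^ i * u" using u(2) l by (auto simp: prime_dvd_mult_iff dest: prime_dvd_power)
  then have "coprime (s ^ i * u) l" using l by (metis coprime_commute prime_imp_coprime)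
  then have "coprime (int (s ^ i * u)) (int l)" by (simp only: coprime_int_iff)
  then obtain z where z: "[int (s ^ i * u) * z = 1] (mod int l)"
    using cong_solve_coprime_int by blast
  \<comment> \<open>With \<open>z\<close> inverse to \<open>s ^ i * u\<close> modulo
    \<open>l\<close>, this choice makes the correction \<open>s ^ i * u * t\<close> equal to the
    defect \<open>v\<close> modulo \<open>l\<close>.\<close>
  define t where "t = nat (z * v mod int l)"
  have "int l > 0" using l by (simp add: prime_gt_0_nat)
  then have t: "int t = z * v mod int l" by (simp add: t_def)
  have "[int (s ^ i * u) * int t = int (s ^ i * u) * (z * v)] (mod int l)"
    unfolding t by (intro cong_scalar_left) (simp add: Cong.cong_def)
  also have "int (s ^ i * u) * (z * v) = (int (s ^ i * u) * z) * v" by simp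
  also have "[\<dots> = 1 * v] (mod int l)" by (intro cong_scalar_right z)
  finally have "int l dvd int (s ^ i * u) * int t - v" by (simp add: cong_iff_dvd_diff)
  then obtain q where q: "int (s ^ i * u) * int t - v = int l * q" by blast
  obtain r where r: "(s ^ (l ^ j)) ^ t = 1 + t * (l ^ (k + j) * u) + (t choose 2) * (l ^ (k + j) * u)\<^sup>2 + (l ^ (k + j) * u) ^ 3 * r"
    using one_plus_power [of "l ^ (k + j) * u" t] u(1) by auto
  have "s ^ (i + l ^ j * t) = s ^ i * (s ^ (l ^ j)) ^ t" by (simp add: power_add power_mult)
  also have "int \<dots> = int (s ^ i) + L * (int (s ^ i * u) * int t) +
      L * L * (int (s ^ i) * (int (t choose 2) * int u ^ 2 + L * int u ^ 3 * int r))"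
    unfolding r L_def by (simp add: algebra_simps power2_eq_square power3_eq_cube)
  also have "int (s ^ i * u) * int t = v + int l * q" using q by simp
  finally have eq: "int (s ^ (i + l ^ j * t)) - int x =
      L * int l * q + L * L * (int (s ^ i) * (int (t choose 2) * int u ^ 2 + L * int u ^ 3 * int r))"
    unfolding v by (simp add: algebra_simps)
  have "int l dvd L" using k by (simp add: L_def dvd_power)
  then have "L * int l dvd int (s ^ (i + l ^ j * t)) - int x"
    unfolding eq by (intro dvd_add) (simp_all add: mult_dvd_mono dvd_mult2)
  moreover have "L * int l = int (l ^ (k + Suc j))" by (simp add: L_def)
  ultimately have "[int (s ^ (i + l ^ j * t)) = int x] (mod int (l ^ (k + Suc j)))"
    by (simp only: cong_iff_dvd_diff)
  then have "[x = s ^ (i + l ^ j * t)] (mod l ^ (k + Suc j))"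
    by (simp only: cong_int_iff cong_sym_eq)
  then show ?case using i(1) by (meson le_add1 order_trans)
qed

text \<open>All numbers of level \<open>k\<close> thus generate the same closed subgroup, and
  inclusion of these subgroups is the reversed order of levels.\<close>

lemma power_closure_level:
  assumes "prime l" "k > 0" "l = 2 \<Longrightarrow> k \<ge> 2" "level l k s"
  shows "power_closure l s x \<longleftrightarrow> [x = 1] (mod l ^ k)"
proof
  assume "power_closure l s x"
  then obtain i where "[x = s ^ i] (mod l ^ k)" unfolding power_closure_def by blast
  moreover have "[s ^ i = 1 ^ i] (mod l ^ k)" using assms(4) unfolding level_def by (intro cong_pow) blast
  ultimately show "[x = 1] (mod l ^ k)" by (metis cong_trans power_one)
next
  assume x: "[x = 1] (mod l ^ k)"
  show "power_closure l s x"
    unfolding power_closure_def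
  proof
    fix m
    obtain i where "i \<ge> 1" "[x = s ^ i] (mod l ^ (k + m))"
      using level_power_approximation [OF assms x] by blast
    then show "\<exists>i\<ge>1. [x = s ^ i] (mod l ^ m)" using cong_prime_power_le by (metis le_add2)
  qed
qed

lemma ex_level:
  assumes "prime l" "s > 1" "[s = 1] (mod l ^ j)"
  obtains k where "k \<ge> j" "level l k s"
proof -
  have "\<not> [s = 1] (mod l ^ s)"
  proof
    assume "[s = 1] (mod l ^ s)"
    then have "l ^ s dvd s - 1" using assms(2) cong_altdef_nat [of 1 s] by simp
    then have "l ^ s \<le> s - 1" using assms(2) by (intro dvd_imp_le) auto
    moreover have "l ^ s > s" using prime_gt_1_nat [OF assms(1)] power_gt_expt [of l s] by simp
    ultimately show False by simp
  qed
  then have ex: "\<exists>k. \<not> [s = 1] (mod l ^ k)" by blast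
  define k where "k = (LEAST k. \<not> [s = 1] (mod l ^ k))"
  have k: "\<not> [s = 1] (mod l ^ k)" unfolding k_def using LeastI_ex [OF ex] .
  then have "k > j" using assms(3) cong_prime_power_le by (metis leI)
  then obtain k' where k': "k = Suc k'" "k' \<ge> j" by (metis less_Suc_eq_le not_less_zero old.nat.exhaust)
  then have "[s = 1] (mod l ^ k')" using not_less_Least [of k' "\<lambda>k. \<not> [s = 1] (mod l ^ k)"] k_def by auto
  then show thesis using k k' by (intro that [of k']) (auto simp: level_def)
qed

section \<open>Primes of exact level\<close>

lemma prime_cong_1_of_ord:
  assumes p: "prime (p::nat)" and l: "prime l" and "k > 0"
    and 1: "[a ^ l ^ k = 1] (mod p)" and 2: "[a ^ l ^ (k - 1) \<noteq> 1] (mod p)"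
  shows "[p = 1] (mod l ^ k)"
proof -
  have "ord p a dvd l ^ k" using 1 ord_divides by blast
  then obtain i where i: "i \<le> k" "ord p a = l ^ i" using divides_primepow_nat [OF l] by blast
  have "\<not> ord p a dvd l ^ (k - 1)" using 2 ord_divides by blast
  then have "\<not> i \<le> k - 1" using i le_imp_power_dvd by metis
  then have "i = k" using i(1) \<open>k > 0\<close> by linarith
  then have ord: "ord p a = l ^ k" using i by simp
  have "\<not> p dvd a"
  proof
    assume "p dvd a"
    moreover have "l ^ k > 0" using l by (simp add: prime_gt_0_nat)
    ultimately have "p dvd a ^ l ^ k" by (meson dvd_power dvd_trans)
    then show False using 1 p by (metis cong_dvd_iff not_prime_unit)
  qed
  then have "[a ^ (p - 1) = 1] (mod p)" by (rule fermat_theorem [OF p])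
  then have "l ^ k dvd p - 1" using ord ord_divides by metis
  then show ?thesis using prime_gt_1_nat [OF p] cong_altdef_nat [of 1 p] by simp
qed

text \<open>The witness is half the value at 3 of the cyclotomic polynomial of order
  \<open>2 ^ k\<close>; modulo each of its prime factors, 3 has order \<open>2 ^ k\<close>. The
  level is exact because 9 has level 3, each squaring adds one and the halving removes one.\<close>

lemma ex_number_level_2:
  fixes k :: nat
  assumes k: "k \<ge> 2"
  obtains N :: nat where "N > 0" "\<And>p. prime p \<Longrightarrow> p dvd N \<Longrightarrow> [p = 1] (mod 2 ^ k)" "[N \<noteq> 1] (mod 2 ^ Suc k)"
proof -
  obtain j where j: "k = Suc (Suc j)" using le_Suc_ex [OF k] by auto
  have "level 2 3 9" by (simp add: level_def Cong.cong_def)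
  then have lev: "level 2 (3 + j) (9 ^ 2 ^ j)" by (intro level_power_prime_power two_is_prime_nat) simp_all
  have "3 + j > 0" by simp
  from iffD1 [OF level_iff [OF two_is_prime_nat this] lev]
  obtain u :: nat where u: "9 ^ 2 ^ j = 1 + 2 ^ (3 + j) * u" "\<not> 2 dvd u" by blast
  define N :: nat where "N = 1 + 2 ^ k * u"
  have N2: "2 * N = 3 ^ (2 ^ (k - 1)) + 1"
  proof -
    have "(3::nat) ^ (2 ^ (k - 1)) = 9 ^ 2 ^ j"
      using power_mult [of "3::nat" 2 "2 ^ j"] by (simp add: j)
    moreover have "2 * N = 1 + 2 ^ (3 + j) * u + 1" by (simp add: N_def j power_add)
    ultimately show ?thesis using u(1) by simp
  qed
  show thesis
  proof (rule that [of N])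
    show "N > 0" by (simp add: N_def)
    have "level 2 k N" using u(2) j by (subst level_iff) (auto simp: N_def)
    then show "[N \<noteq> 1] (mod 2 ^ Suc k)" by (simp add: level_def)
  next
    fix p assume p: "prime p" "p dvd N"
    define Z :: nat where "Z = 3 ^ (2 ^ (k - 1))"
    have p2: "p dvd Z + 1" using p(2) dvd_mult [of p N 2] by (simp add: N2 Z_def)
    have "odd N" by (simp add: N_def j)
    then have "p \<noteq> 2" using p(2) by auto
    have "int p dvd int (Z + 1)" using p2 by (simp only: int_dvd_int_iff)
    then have "[int Z = - 1] (mod int p)" by (simp add: cong_iff_dvd_diff add.commute)
    then have "[(int Z)\<^sup>2 = (- 1)\<^sup>2] (mod int p)" by (rule cong_pow)
    then have "[int (Z\<^sup>2) = int 1] (mod int p)" by simp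
    then have "[Z\<^sup>2 = 1] (mod p)" by (simp only: cong_int_iff)
    moreover have "Z\<^sup>2 = 3 ^ 2 ^ k"
      unfolding Z_def power_mult [symmetric] by (simp add: j)
    moreover have "[Z \<noteq> 1] (mod p)"
    proof
      assume "[Z = 1] (mod p)"
      then have "[Z + 1 = 1 + 1] (mod p)" by (rule cong_add) simp
      then have "p dvd 1 + 1" using p2 cong_dvd_iff by blast
      then have "p dvd 2" unfolding one_add_one .
      then show False using \<open>p \<noteq> 2\<close> p(1) primes_dvd_imp_eq two_is_prime_nat by blast
    qed
    ultimately show "[p = 1] (mod 2 ^ k)"
      using k by (intro prime_cong_1_of_ord [OF p(1) two_is_prime_nat, where a = 3]) (auto simp: Z_def)
  qed
qed

text \<open>The witness is the value at \<open>l - 1\<close> of the cyclotomic polynomial of order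
  \<open>l ^ k\<close>. This base is -1 modulo \<open>l\<close>, which keeps \<open>l\<close> from
  dividing \<open>N\<close>, and its square \<open>1 + l * (l - 2)\<close> has level 1. Hence
  \<open>y ^ (l - 1)\<close> has level exactly \<open>k\<close>, and
  \<open>(y - 1) * (N - 1) = y * (y ^ (l - 1) - 1)\<close> bounds the power of \<open>l\<close> in
  \<open>N - 1\<close>.\<close>

lemma ex_number_level_odd:
  fixes l k :: nat
  assumes l: "prime l" and odd: "odd l" and k: "k > 0"
  obtains N :: nat where "N > 0" "\<And>p. prime p \<Longrightarrow> p dvd N \<Longrightarrow> [p = 1] (mod l ^ k)" "[N \<noteq> 1] (mod l ^ Suc k)"
proof -
  have l2: "l > 2" using odd prime_ge_2_nat [OF l] by (cases "l = 2") auto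
  obtain k' where k': "k = Suc k'" using k gr0_implies_Suc by blast
  obtain t where t: "l = 2 * t + 1" using odd by (elim oddE)
  define y where "y = (l - 1) ^ (l ^ k')"
  have "(l - 1)\<^sup>2 = 1 + l ^ 1 * (l - 2)"
  proof -
    have "l - 1 = 2 * t" "l - 2 = 2 * t - 1" "t > 0" using t l2 by auto
    then show ?thesis by (cases t) (auto simp: t power2_eq_square algebra_simps)
  qed
  moreover have "\<not> l dvd l - 2" using l2 by (auto dest: dvd_imp_le)
  ultimately have "level l 1 ((l - 1)\<^sup>2)" using level_iff [OF l, of 1] by auto
  then have "level l (1 + k') (((l - 1)\<^sup>2) ^ (l ^ k'))"
    using l odd by (intro level_power_prime_power) auto
  then have "level l k (y\<^sup>2)" by (simp add: y_def k' power_mult [symmetric] mult.commute)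
  moreover have "\<not> l dvd t" using t l2 by (auto dest: dvd_imp_le)
  ultimately have "level l k ((y\<^sup>2) ^ t)" using level_power_coprime [OF l k] by blast
  moreover have "(y\<^sup>2) ^ t = y ^ (l - 1)" by (simp add: t power_mult)
  ultimately have lev: "level l k (y ^ (l - 1))" by simp
  define N where "N = (\<Sum>i<l. y ^ i)"
  have yN: "(int y - 1) * int N = int y ^ l - 1"
    unfolding N_def by (simp add: power_diff_1_eq)
  have ym: "[int y = - 1] (mod int l)"
  proof -
    have "[int (l - 1) = - 1] (mod int l)" using l2 by (simp add: cong_iff_dvd_diff of_nat_diff)
    then have "[int (l - 1) ^ (l ^ k') = (- 1) ^ (l ^ k')] (mod int l)" by (rule cong_pow)
    then show ?thesis using odd by (simp add: y_def)
  qed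
  have "\<not> l dvd y"
  proof
    assume "l dvd y"
    then have "int l dvd - 1" using cong_dvd_iff [OF ym] by simp
    then show False using l2 by simp
  qed
  have "\<not> l dvd N"
  proof
    assume "l dvd N"
    then have "int l dvd int y ^ l - 1"
      unfolding yN [symmetric] by simp
    moreover have "[int y ^ l = (- 1) ^ l] (mod int l)" using ym by (rule cong_pow)
    then have "int l dvd int y ^ l + 1" using odd by (simp add: cong_iff_dvd_diff)
    ultimately have "int l dvd (int y ^ l + 1) - (int y ^ l - 1)" by (rule dvd_diff [rotated])
    then have "int l dvd 2" by simp
    then show False using l2 by (auto dest: zdvd_imp_le)
  qed
  show thesis
  proof (rule that [of N])
    have "y ^ 0 \<le> N" unfolding N_def using l2 by (intro member_le_sum) auto
    then show "N > 0" by simp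
  next
    show "[N \<noteq> 1] (mod l ^ Suc k)"
    proof
      assume "[N = 1] (mod l ^ Suc k)"
      then have "[int N = int 1] (mod int (l ^ Suc k))" by (simp only: cong_int_iff)
      then have "int (l ^ Suc k) dvd (int y - 1) * (int N - 1)" by (simp add: cong_iff_dvd_diff)
      also have "(int y - 1) * (int N - 1) = (int y - 1) * int N - (int y - 1)" by (simp add: algebra_simps)
      also have "\<dots> = int y * (int y ^ (l - 1) - 1)"
        unfolding yN
        using l2 by (simp add: algebra_simps flip: power_Suc)
      finally have "int (l ^ Suc k) dvd int y * (int y ^ (l - 1) - 1)" .
      moreover have "coprime (int (l ^ Suc k)) (int y)"
        using \<open>\<not> l dvd y\<close> l by (simp add: prime_imp_coprime del: power_Suc of_nat_power)
      ultimately have "int (l ^ Suc k) dvd int y ^ (l - 1) - 1"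
        by (simp only: coprime_dvd_mult_right_iff)
      then have "[int (y ^ (l - 1)) = int 1] (mod int (l ^ Suc k))" by (simp add: cong_iff_dvd_diff)
      then have "[y ^ (l - 1) = 1] (mod l ^ Suc k)" by (simp only: cong_int_iff)
      then show False using lev by (simp add: level_def)
    qed
  next
    fix p assume p: "prime p" "p dvd N"
    have "int p dvd int y ^ l - 1"
      unfolding yN [symmetric] using p(2) by simp
    then have "[int (y ^ l) = int 1] (mod int p)" by (simp add: cong_iff_dvd_diff)
    then have "[y ^ l = 1] (mod p)" by (simp only: cong_int_iff)
    then have "[(l - 1) ^ l ^ k = 1] (mod p)"
      by (simp add: y_def k' power_mult [symmetric] mult.commute)
    moreover have "[y \<noteq> 1] (mod p)"
    proof
      assume "[y = 1] (mod p)"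
      then have "[N = (\<Sum>i<l. 1 ^ i)] (mod p)" unfolding N_def by (intro cong_sum cong_pow)
      then have "p dvd l" using p(2) by (simp add: cong_dvd_iff)
      then have "p = l" using p(1) l primes_dvd_imp_eq by blast
      then show False using p(2) \<open>\<not> l dvd N\<close> by simp
    qed
    ultimately show "[p = 1] (mod l ^ k)"
      using k' by (intro prime_cong_1_of_ord [OF p(1) l]) (auto simp: y_def)
  qed
qed

text \<open>The prime factors of \<open>N\<close> are all 1 modulo \<open>l ^ k\<close>; if all were
  1 modulo \<open>l ^ Suc k\<close>, so would be their product.\<close>

lemma ex_prime_level:
  fixes l k :: nat
  assumes l: "prime l" and k: "k > 0" "l = 2 \<Longrightarrow> k \<ge> 2"
  obtains s where "prime s" "s \<noteq> l" "level l k s"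
proof -
  obtain N :: nat where N: "N > 0" "\<And>p. prime p \<Longrightarrow> p dvd N \<Longrightarrow> [p = 1] (mod l ^ k)" "[N \<noteq> 1] (mod l ^ Suc k)"
  proof (cases "l = 2")
    case True
    show thesis by (rule ex_number_level_2 [OF k(2) [OF True]]) (use True that in blast)
  next
    case False
    then have "odd l" using l primes_dvd_imp_eq two_is_prime_nat by blast
    show thesis by (rule ex_number_level_odd [OF l \<open>odd l\<close> k(1)]) (use that in blast)
  qed
  obtain s where s: "prime s" "s dvd N" "[s \<noteq> 1] (mod l ^ Suc k)"
    using cong_1_prod_primes [OF N(1)] N(3) by blast
  have "[s = 1] (mod l ^ k)" using N(2) s by blast
  moreover have "s \<noteq> l"
  proof
    assume "s = l"
    then have "[l = 1] (mod l)" using \<open>[s = 1] (mod l ^ k)\<close> k(1) cong_prime_power_le [of s 1 l k 1] by simp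
    then show False using l by (metis cong_dvd_iff dvd_refl not_prime_unit)
  qed
  ultimately show thesis using s by (intro that [of s]) (auto simp: level_def)
qed

section \<open>Chains of closed subgroups generated by primes\<close>

lemma power_closure_trans:
  assumes "power_closure l c b" "power_closure l b a"
  shows "power_closure l c a"
  unfolding power_closure_def
proof
  fix m
  obtain i where i: "i \<ge> 1" "[a = b ^ i] (mod l ^ m)" using assms(2) power_closure_def by blast
  obtain j where j: "j \<ge> 1" "[b = c ^ j] (mod l ^ m)" using assms(1) power_closure_def by blast
  have "[b ^ i = (c ^ j) ^ i] (mod l ^ m)" using j(2) by (rule cong_pow)
  then have "[a = c ^ (j * i)] (mod l ^ m)" using i(2) cong_trans by (simp add: power_mult) blast
  moreover have "j * i \<ge> 1" using i j by (metis mult_le_mono nat_mult_1)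
  ultimately show "\<exists>i\<ge>1. [a = c ^ i] (mod l ^ m)" by blast
qed

lemma power_closure_refl: "power_closure l b b"
  unfolding power_closure_def by (metis cong_refl order_refl power_one_right)

lemma power_closure_power:
  assumes "power_closure l b x" "i \<ge> 1"
  shows "power_closure l b (x ^ i)"
proof (rule power_closure_trans [OF assms(1)])
  show "power_closure l x (x ^ i)"
    unfolding power_closure_def using assms(2) by (metis cong_refl)
qed

lemma power_closure_base:
  assumes "power_closure l (b ^ e) x" "e \<ge> 1"
  shows "power_closure l b x"
  using power_closure_trans [OF power_closure_power [OF power_closure_refl assms(2)] assms(1)] .

text \<open>The numbers \<open>a\<close> and \<open>c\<close> are primes because
  \<open>\<sigma>\<close> acts on primes only; in this form the condition can be transported along
  \<open>\<sigma>\<close>.\<close>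

definition chain_prime :: "nat \<Rightarrow> nat \<Rightarrow> bool" where
  "chain_prime l b \<longleftrightarrow> prime b \<and> b \<noteq> l \<and> (\<forall>a c. prime a \<longrightarrow> prime c \<longrightarrow>
     power_closure l b a \<longrightarrow> power_closure l b c \<longrightarrow> power_closure l a c \<or> power_closure l c a)"

lemma cong_1_power_prime_power:
  assumes "prime l" "[b = 1] (mod (l::nat))"
  shows "[b ^ l ^ m = 1] (mod l ^ m)"
proof (cases "b > 1")
  case True
  have lev: "\<exists>u. b ^ l ^ m = 1 + l ^ m * u" for m
  proof (induction m)
    case 0
    then show ?case using True by (intro exI [of _ "b - 1"]) simp
  next
    case (Suc m)
    then obtain u where u: "b ^ l ^ m = 1 + l ^ m * u" by blast
    \<comment> \<open>Immediate for positive \<open>m\<close>; at \<open>m = 0\<close> this is where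
      the hypothesis on \<open>b\<close> enters.\<close>
    have lu: "l dvd l ^ m * u"
    proof -
      have "[b ^ l ^ m = 1 ^ l ^ m] (mod l)" using assms(2) by (rule cong_pow)
      then have "[1 + l ^ m * u = 1 + 0] (mod l)" by (simp add: u)
      then show ?thesis by (simp only: cong_add_lcancel_nat cong_0_iff)
    qed
    obtain r where r: "(1 + l ^ m * u) ^ l = 1 + l * (l ^ m * u) + (l choose 2) * (l ^ m * u)\<^sup>2 + (l ^ m * u) ^ 3 * r"
      using one_plus_power [of "l ^ m * u" l] by blast
    have "l ^ Suc m dvd (l ^ m * u) * (l ^ m * u)"
      using mult_dvd_mono [of "l ^ m" "l ^ m * u" l "l ^ m * u"] lu by (simp add: mult.commute)
    then obtain v where v: "(l ^ m * u) * (l ^ m * u) = l ^ Suc m * v" by blast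
    have sq: "(l ^ m * u)\<^sup>2 = l ^ Suc m * v" by (simp only: power2_eq_square v)
    have cube: "(l ^ m * u) ^ 3 = l ^ Suc m * v * (l ^ m * u)" by (simp only: power3_eq_cube v)
    have "(b ^ l ^ m) ^ l = 1 + l ^ Suc m * (u + (l choose 2) * v + v * (l ^ m * u) * r)"
      unfolding u r sq cube by (simp add: algebra_simps)
    moreover have "b ^ l ^ Suc m = (b ^ l ^ m) ^ l" by (simp add: power_mult [symmetric] mult.commute)
    ultimately show ?case by auto
  qed
  then obtain u where "b ^ l ^ m = 1 + l ^ m * u" by blast
  moreover have "[1 + l ^ m * u = 1 + 0] (mod l ^ m)" by (intro cong_add) (auto simp: cong_0_iff)
  ultimately show ?thesis by simp
next
  case False
  have "b \<noteq> 0"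
  proof
    assume "b = 0"
    then have "l dvd 1" using assms(2) using cong_0_iff cong_sym by blast
    then show False using assms(1) by (simp add: prime_nat_iff)
  qed
  with False have "b = 1" by simp
  then show ?thesis by simp
qed

text \<open>The order of \<open>b\<close> modulo \<open>l ^ m\<close> is a power of
  \<open>l\<close>, so exponents prime to \<open>l\<close> are invertible and the group generated by
  \<open>b ^ i\<close> depends only on the power of \<open>l\<close> in \<open>i\<close>.\<close>

lemma chain_prime_cong_1:
  assumes l: "prime l" and b: "prime b" "[b = 1] (mod l)"
  shows "chain_prime l b"
  unfolding chain_prime_def
proof (intro conjI allI impI)
  show "b \<noteq> l"
  proof
    assume "b = l"
    then have "l dvd 1" using cong_dvd_iff [OF b(2)] by simp
    then show False using l by (simp add: prime_nat_iff)
  qed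
next
  fix a c assume a: "power_closure l b a" and c: "power_closure l b c"
  define P where "P m x y \<longleftrightarrow> (\<exists>i\<ge>1. [y = x ^ i] (mod l ^ m))" for m x y
  have mono: "P m x y" if xy: "P m' x y" "m \<le> m'" for m m' x y
  proof -
    obtain i where "i \<ge> 1" "[y = x ^ i] (mod l ^ m')" using xy(1) unfolding P_def by blast
    with cong_prime_power_le [OF this(2) xy(2)] show ?thesis unfolding P_def by blast
  qed
  have coprime_solve: "P m (b ^ (l ^ u * i)) (b ^ (l ^ w * j))" if "u \<le> w" "\<not> l dvd i" "j \<ge> 1" for m u w i j
  proof -
    have "coprime l i" using that(2) l by (simp add: prime_imp_coprime)
    then have "coprime i (l ^ m)" by (simp add: coprime_commute)
    then obtain x where x: "[i * x = 1] (mod l ^ m)" using cong_solve_coprime_nat [of i "l ^ m"] unfolding One_nat_def by blast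
    define t where "t = x * l ^ (w - u) * j + l ^ m"
    have "[l ^ u * i * t = l ^ u * i * (x * l ^ (w - u) * j + 0)] (mod l ^ m)"
      unfolding t_def by (intro cong_scalar_left cong_add) (auto simp: cong_0_iff)
    also have "l ^ u * i * (x * l ^ (w - u) * j + 0) = (i * x) * (l ^ u * l ^ (w - u) * j)" by simp
    also have "[\<dots> = 1 * (l ^ u * l ^ (w - u) * j)] (mod l ^ m)" using x by (rule cong_scalar_right)
    also have "l ^ u * l ^ (w - u) = l ^ w" using \<open>u \<le> w\<close> power_add [of l u "w - u"] by simp
    finally have "[l ^ u * i * t = l ^ w * j] (mod l ^ m)" by simp
    moreover have "ord (l ^ m) b dvd l ^ m"
      using cong_1_power_prime_power [OF l b(2), of m] ord_divides by blast
    ultimately have "[l ^ u * i * t = l ^ w * j] (mod ord (l ^ m) b)" by (rule cong_dvd_modulus_nat)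
    moreover have "coprime (l ^ m) b"
      using cong_imp_coprime [OF cong_sym [OF b(2)]] by (simp add: coprime_commute)
    ultimately have "[b ^ (l ^ u * i * t) = b ^ (l ^ w * j)] (mod l ^ m)"
      using order_divides_expdiff by blast
    then have "[b ^ (l ^ w * j) = (b ^ (l ^ u * i)) ^ t] (mod l ^ m)" by (simp only: power_mult cong_sym)
    moreover have "t \<ge> 1"
    proof -
      have "l ^ m > 0" using l by (simp add: prime_gt_0_nat)
      then show ?thesis unfolding t_def by linarith
    qed
    ultimately show ?thesis unfolding P_def by blast
  qed
  have "P m a c \<or> P m c a" for m
  proof -
    obtain i j where ij: "i \<ge> 1" "j \<ge> 1" "[a = b ^ i] (mod l ^ m)" "[c = b ^ j] (mod l ^ m)"
      using a c unfolding power_closure_def by meson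
    have unit: "\<not> is_unit l" using l not_prime_unit by blast
    have "i \<noteq> 0" "j \<noteq> 0" using ij by auto
    then obtain i' j' where i': "i = l ^ multiplicity l i * i'" "\<not> l dvd i'"
      and j': "j = l ^ multiplicity l j * j'" "\<not> l dvd j'"
      using unit multiplicity_decompose' by metis
    then have "i' \<ge> 1" "j' \<ge> 1" by (auto intro: Suc_leI gr0I)
    then have "P m (b ^ i) (b ^ j) \<or> P m (b ^ j) (b ^ i)"
      using coprime_solve [of "multiplicity l i" "multiplicity l j" i' j' m]
        coprime_solve [of "multiplicity l j" "multiplicity l i" j' i' m]
        i'(1) [symmetric] j'(1) [symmetric] i'(2) j'(2)
      by (cases "multiplicity l i \<le> multiplicity l j") simp_all
    moreover have "P m x' y'" if "P m x y" "[x' = x] (mod l ^ m)" "[y' = y] (mod l ^ m)" for x y x' y'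
      using that unfolding P_def by (meson cong_pow cong_sym cong_trans)
    ultimately show ?thesis using ij by blast
  qed
  \<comment> \<open>Which alternative holds may vary with \<open>m\<close>, but \<open>P\<close>
    passes to smaller \<open>m\<close>, so one of them holds for all \<open>m\<close>.\<close>
  then have "(\<forall>m. P m a c) \<or> (\<forall>m. P m c a)"
    using mono by (metis nat_le_linear)
  then show "power_closure l a c \<or> power_closure l c a"
    unfolding power_closure_def P_def .
qed (use b in auto)

text \<open>The units modulo \<open>l\<close> form a cyclic group, which has only one subgroup of
  each order; the proof compares exponents of a primitive root.\<close>

lemma prime_power_of_ord:
  assumes l: "prime (l::nat)" and bl: "\<not> l dvd b" and r: "[r ^ ord l b = 1] (mod l)"
  obtains i where "[r = b ^ i] (mod l)"
proof -
  obtain g where "g \<in> totatives l" and g: "ord l g = l - 1"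
    using residue_prime_has_primroot [OF l] by blast
  then have cg: "coprime l g" by (simp add: totatives_def coprime_commute)
  have prim: "residue_primroot l g"
    using l cg g by (simp add: residue_primroot_def totient_prime prime_gt_0_nat)
  have cb: "coprime l b" using bl l by (simp add: prime_imp_coprime)
  have e: "ord l b > 0" using cb by (simp add: ord_eq_0)
  have "\<not> l dvd r"
  proof
    assume "l dvd r"
    then have "l dvd r ^ ord l b" using e by (meson dvd_power dvd_trans)
    then have "l dvd 1" using cong_dvd_iff [OF r] by simp
    then show False using l by (simp add: prime_nat_iff)
  qed
  then have cr: "coprime l r" using l by (simp add: prime_imp_coprime)
  obtain x where x: "[r = g ^ x] (mod l)"
    using primroot_generates [OF prime_gt_1_nat [OF l] prim, of r] cr by (auto simp: coprime_commute)
  obtain y where y: "[b = g ^ y] (mod l)"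
    using primroot_generates [OF prime_gt_1_nat [OF l] prim, of b] cb by (auto simp: coprime_commute)
  define n where "n = l - 1"
  have n: "n > 0" using prime_gt_1_nat [OF l] by (simp add: n_def)
  define d where "d = gcd y n"
  have d: "d > 0" "d dvd y" "d dvd n" using n by (auto simp: d_def)
  have eq: "[g ^ u = g ^ v] (mod l) \<longleftrightarrow> [u = v] (mod n)" for u v
    using order_divides_expdiff [OF cg] g by (simp add: n_def)
  have "[g ^ (x * ord l b) = g ^ 0] (mod l)"
    using cong_pow [OF x, of "ord l b"] r by (simp add: power_mult) (metis cong_sym cong_trans)
  then have "[x * ord l b = 0] (mod n)" by (simp only: eq)
  then have 1: "n dvd x * ord l b" by (simp only: cong_0_iff)
  have "n dvd y * (n div d)"
    using d by (metis dvd_div_mult dvd_triv_right div_mult_swap dvd_def mult.commute dvd_mult_div_cancel)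
  then have "[g ^ (y * (n div d)) = g ^ 0] (mod l)" by (simp only: eq cong_0_iff)
  then have "[b ^ (n div d) = 1] (mod l)"
    using cong_pow [OF y, of "n div d"] by (simp add: power_mult) (metis cong_trans)
  then have "ord l b dvd n div d" using ord_divides by blast
  then have "x * ord l b dvd x * (n div d)" by simp
  then have "n dvd x * (n div d)" using 1 dvd_trans by blast
  then have "d * (n div d) dvd x * (n div d)" using d by simp
  moreover have "n div d > 0" using d n by (simp add: div_greater_zero_iff dvd_imp_le)
  ultimately have "d dvd x" by simp
  then obtain t where "[y * t = x] (mod n)"
    using cong_solve_nat [of y n] n unfolding d_def
    by (metis cong_scalar_right dvd_def mult.assoc gr0I mult.commute)
  then have "[g ^ (y * t) = g ^ x] (mod l)" by (simp add: eq)
  moreover have "[b ^ t = g ^ (y * t)] (mod l)" using cong_pow [OF y, of t] by (simp add: power_mult)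
  ultimately have "[r = b ^ t] (mod l)" using x by (meson cong_sym cong_trans)
  then show thesis by (rule that)
qed

text \<open>In the factorization of \<open>y ^ e - 1\<close> by \<open>y - 1\<close>, the cofactor
  is \<open>e\<close> modulo \<open>l\<close>, hence prime to \<open>l\<close>: the units congruent
  to 1 have no \<open>e\<close>-torsion.\<close>

lemma cong_1_root_lift:
  assumes l: "prime (l::nat)" and y: "[y = 1] (mod l)" and ye: "[y ^ e = 1] (mod l ^ j)" and e: "\<not> l dvd e"
  shows "[y = 1] (mod l ^ j)"
proof -
  have "[int (y ^ e) = int 1] (mod int (l ^ j))" using ye by (simp only: cong_int_iff)
  then have "int (l ^ j) dvd (int y - 1) * (\<Sum>i<e. int y ^ i)"
    by (simp add: cong_iff_dvd_diff power_diff_1_eq)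
  moreover have "coprime (int (l ^ j)) (\<Sum>i<e. int y ^ i)"
  proof -
    have "[(\<Sum>i<e. y ^ i) = (\<Sum>i<e. 1 ^ i)] (mod l)" using y by (intro cong_sum cong_pow)
    then have "[(\<Sum>i<e. y ^ i) = e] (mod l)" by simp
    then have "\<not> l dvd (\<Sum>i<e. y ^ i)" using e by (simp add: cong_dvd_iff)
    then have "coprime (l ^ j) (\<Sum>i<e. y ^ i)" using l by (simp add: prime_imp_coprime)
    then have "coprime (int (l ^ j)) (int (\<Sum>i<e. y ^ i))" by (simp only: coprime_int_iff)
    then show ?thesis by simp
  qed
  ultimately have "int (l ^ j) dvd int y - 1" by (simp only: coprime_dvd_mult_left_iff)
  then have "[int y = int 1] (mod int (l ^ j))" by (simp add: cong_iff_dvd_diff)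
  then show ?thesis by (simp only: cong_int_iff)
qed

text \<open>Let \<open>e > 1\<close> be the order of \<open>b\<close> modulo \<open>l\<close> and
  \<open>j\<close> the level of \<open>b ^ e\<close>. Two incomparable primes lie in the group of
  \<open>b\<close>: \<open>s\<close> of level \<open>j\<close>, and \<open>r\<close> imitating a
  nontrivial root of unity of order dividing \<open>e\<close>. If \<open>s\<close> is in the group
  of \<open>r\<close>, then \<open>s ^ e\<close> and so \<open>s\<close> is 1 modulo
  \<open>l ^ Suc j\<close>, against its level; and everything in the group of \<open>s\<close> is 1
  modulo \<open>l\<close>, unlike \<open>r\<close>.\<close>

lemma chain_prime_imp_cong_1:
  assumes l: "prime l" "odd l" and chain: "chain_prime l b"
  shows "[b = 1] (mod l)"
proof (rule ccontr)
  assume b1: "[b \<noteq> 1] (mod l)"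
  have b: "prime b" "b \<noteq> l" using chain by (auto simp: chain_prime_def)
  have bl: "\<not> l dvd b" using b l primes_dvd_imp_eq by blast
  then have cb: "coprime l b" using l by (simp add: prime_imp_coprime)
  define e where "e = ord l b"
  have be: "[b ^ e = 1] (mod l)" unfolding e_def by (rule ord)
  have "e > 0" using cb by (simp add: e_def ord_eq_0)
  moreover have "e \<noteq> 1" using be b1 by auto
  ultimately have e1: "e > 1" by simp
  have "[b ^ (l - 1) = 1] (mod l)" by (rule fermat_theorem [OF l(1) bl])
  then have el: "e dvd l - 1" unfolding e_def using ord_divides by blast
  have "\<not> l dvd e"
  proof
    assume "l dvd e"
    then have "l dvd l - 1" using el dvd_trans by blast
    then have "l \<le> l - 1" using prime_gt_1_nat [OF l(1)] by (intro dvd_imp_le) auto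
    then show False using prime_gt_1_nat [OF l(1)] by simp
  qed
  have "b ^ e > 1" using one_less_power [OF prime_gt_1_nat [OF b(1)] \<open>e > 0\<close>] .
  moreover have "[b ^ e = 1] (mod l ^ 1)" using be by simp
  ultimately obtain j where j: "j \<ge> 1" "level l j (b ^ e)" by (rule ex_level [OF l(1)])
  then have bej: "[b ^ e = 1] (mod l ^ j)" by (simp add: level_def)
  have j2: "j > 0" "l = 2 \<Longrightarrow> j \<ge> 2" using j(1) l(2) by auto
  obtain s where s: "prime s" "s \<noteq> l" "level l j s" by (rule ex_prime_level [OF l(1) j2])
  then have s1: "[s = 1] (mod l ^ j)" by (simp add: level_def)
  have sl: "[s = 1] (mod l)" using cong_prime_power_le [OF s1, of 1] j(1) by simp
  obtain r where r: "prime r" "[r ^ e = 1] (mod l ^ Suc j)" "[r \<noteq> 1] (mod l)"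
    by (rule ex_prime_in_subgroup [OF l el e1])
  have rj: "[r ^ e = 1] (mod l ^ j)" using cong_prime_power_le [OF r(2), of j] by simp
  have rl: "[r ^ e = 1] (mod l)" using cong_prime_power_le [OF r(2), of 1] by simp
  have bs: "power_closure l b s"
    using power_closure_level [OF l(1) j2 j(2)] s1 e1 by (intro power_closure_base [of l b e]) auto
  obtain i where i: "[r = b ^ i] (mod l)"
    using prime_power_of_ord [OF l(1) bl] rl unfolding e_def by blast
  have be_pow: "[b ^ (e * k) = 1] (mod l ^ j)" for k
    using cong_pow [OF bej, of k] by (simp add: power_mult)
  \<comment> \<open>Up to a power of \<open>b ^ e\<close> this is the quotient of \<open>r\<close>
    by \<open>b ^ i\<close>, so it is congruent to 1 and falls into the group generated by
    \<open>b ^ e\<close>.\<close>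
  define y where "y = r * b ^ ((e - 1) * i)"
  have "[y = b ^ i * b ^ ((e - 1) * i)] (mod l)"
    unfolding y_def using i by (rule cong_scalar_right)
  also have "b ^ i * b ^ ((e - 1) * i) = b ^ (e * i)"
  proof -
    have "i + (e - 1) * i = e * i" using e1 by (cases e) auto
    then show ?thesis by (metis power_add)
  qed
  also have "[b ^ (e * i) = 1] (mod l)"
    using cong_pow [OF be, of i] by (simp add: power_mult)
  finally have y1: "[y = 1] (mod l)" .
  have "[r ^ e * b ^ (e * ((e - 1) * i)) = 1 * 1] (mod l ^ j)"
    using rj be_pow by (rule cong_mult)
  moreover have "y ^ e = r ^ e * b ^ (e * ((e - 1) * i))"
    by (simp add: y_def power_mult_distrib power_mult [symmetric] mult.commute)
  ultimately have "[y ^ e = 1] (mod l ^ j)" by simp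
  then have yj: "[y = 1] (mod l ^ j)" by (rule cong_1_root_lift [OF l(1) y1 _ \<open>\<not> l dvd e\<close>])
  have br: "power_closure l b r"
    unfolding power_closure_def
  proof
    fix M
    have "power_closure l (b ^ e) y" using power_closure_level [OF l(1) j2 j(2)] yj by blast
    then obtain t where t: "t \<ge> 1" "[y = (b ^ e) ^ t] (mod l ^ M)" unfolding power_closure_def by blast
    \<comment> \<open>By Euler's theorem, inverses of powers of \<open>b\<close> modulo
      \<open>l ^ M\<close> can be written with nonnegative exponents.\<close>
    define T where "T = totient (l ^ M)"
    have T: "T \<ge> 1" using l by (simp add: T_def prime_gt_0_nat Suc_le_eq)
    have "coprime b (l ^ M)" using cb by (simp add: coprime_commute)
    then have bT: "[b ^ T = 1] (mod l ^ M)" unfolding T_def by (rule euler_theorem)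
    define q where "q = (e - 1) * i"
    have "[b ^ (T * q) = 1] (mod l ^ M)" using cong_pow [OF bT, of q] by (simp add: power_mult)
    then have "[r * b ^ (T * q) = r * 1] (mod l ^ M)" by (rule cong_scalar_left)
    moreover have "r * b ^ (T * q) = y * b ^ ((T - 1) * q)"
    proof -
      have "T * q = q + (T - 1) * q" using T by (cases T) auto
      then show ?thesis unfolding y_def q_def [symmetric] by (simp add: power_add)
    qed
    moreover have "[y * b ^ ((T - 1) * q) = (b ^ e) ^ t * b ^ ((T - 1) * q)] (mod l ^ M)"
      using t(2) by (rule cong_scalar_right)
    moreover have "(b ^ e) ^ t * b ^ ((T - 1) * q) = b ^ (e * t + (T - 1) * q)"
      by (simp add: power_add power_mult)
    ultimately have "[r = b ^ (e * t + (T - 1) * q)] (mod l ^ M)"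
      by (metis cong_sym cong_trans mult_1_right)
    moreover have "e * t + (T - 1) * q \<ge> 1"
    proof -
      have "e * t > 0" using e1 t(1) by simp
      then show ?thesis by linarith
    qed
    ultimately show "\<exists>i\<ge>1. [r = b ^ i] (mod l ^ M)" by blast
  qed
  have "power_closure l r s \<or> power_closure l s r"
    using chain br bs r(1) s(1) unfolding chain_prime_def by blast
  then show False
  proof
    assume "power_closure l r s"
    then obtain k where k: "[s = r ^ k] (mod l ^ Suc j)" unfolding power_closure_def by blast
    have "[s ^ e = (r ^ k) ^ e] (mod l ^ Suc j)" using k by (rule cong_pow)
    moreover have "(r ^ k) ^ e = (r ^ e) ^ k" by (simp add: power_mult [symmetric] mult.commute)
    moreover have "[(r ^ e) ^ k = 1 ^ k] (mod l ^ Suc j)" using r(2) by (rule cong_pow)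
    ultimately have "[s ^ e = 1] (mod l ^ Suc j)" using cong_trans by fastforce
    then have "[s = 1] (mod l ^ Suc j)" by (rule cong_1_root_lift [OF l(1) sl _ \<open>\<not> l dvd e\<close>])
    then show False using s(3) by (simp add: level_def)
  next
    assume "power_closure l s r"
    then obtain k where k: "[r = s ^ k] (mod l ^ 1)" unfolding power_closure_def by blast
    moreover have "[s ^ k = 1 ^ k] (mod l)" using sl by (rule cong_pow)
    ultimately have "[r = 1] (mod l)" using cong_trans by fastforce
    then show False using r(3) by blast
  qed
qed

section \<open>The Golomb topology\<close>

lemma mem_arith_prog: "y \<in> arith_prog a b \<longleftrightarrow> a \<le> y \<and> [y = a] (mod b)"
proof
  assume "a \<le> y \<and> [y = a] (mod b)"
  then obtain q where "y = q * b + a" using cong_le_nat by blast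
  then show "y \<in> arith_prog a b" by (auto simp: arith_prog_def mult.commute)
qed (auto simp: arith_prog_def Cong.cong_def)

lemma topspace_golomb: "topspace golomb_topology = {1..}"
proof
  show "topspace golomb_topology \<subseteq> {1..}"
    by (auto simp: golomb_topology_def golomb_base_def arith_prog_def)
  have "arith_prog 1 1 \<in> golomb_base" unfolding golomb_base_def by force
  moreover have "{1..} \<subseteq> arith_prog 1 1" by (auto simp: mem_arith_prog Cong.cong_def)
  ultimately show "{1..} \<subseteq> topspace golomb_topology"
    unfolding golomb_topology_def by auto
qed

lemma openin_arith_prog: "a \<ge> 1 \<Longrightarrow> b \<ge> 1 \<Longrightarrow> coprime a b \<Longrightarrow> openin golomb_topology (arith_prog a b)"
  unfolding golomb_topology_def golomb_base_def
  by (rule topology_generated_by_Basis) blast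

lemma openin_golombE:
  assumes "openin golomb_topology U" "x \<in> U"
  obtains b where "b \<ge> 1" "coprime x b" "arith_prog x b \<subseteq> U"
proof -
  have "generate_topology_on golomb_base U"
    using assms(1) unfolding golomb_topology_def by (rule openin_topology_generated_by)
  then have "\<exists>b\<ge>1. coprime x b \<and> arith_prog x b \<subseteq> U"
    using assms(2)
  proof (induction arbitrary: x)
    case (Int U V)
    obtain b where b: "b \<ge> 1" "coprime x b" "arith_prog x b \<subseteq> U" using Int by blast
    obtain c where c: "c \<ge> 1" "coprime x c" "arith_prog x c \<subseteq> V" using Int by blast
    have "arith_prog x (b * c) \<subseteq> arith_prog x b" "arith_prog x (b * c) \<subseteq> arith_prog x c"
      using cong_dvd_modulus_nat [of _ x "b * c"] by (auto simp: mem_arith_prog)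
    then show ?case using b c by (intro exI [of _ "b * c"]) auto
  next
    case (UN K)
    then show ?case by blast
  next
    case (Basis U)
    then obtain a b where ab: "U = arith_prog a b" "a \<ge> 1" "b \<ge> 1" "coprime a b"
      unfolding golomb_base_def by blast
    then have x: "a \<le> x" "[x = a] (mod b)" using Basis by (auto simp: mem_arith_prog)
    have "coprime x b" using cong_imp_coprime [OF cong_sym [OF x(2)] ab(4)] .
    moreover have "arith_prog x b \<subseteq> U"
      using x unfolding ab(1) by (auto simp: mem_arith_prog intro: cong_trans)
    ultimately show ?case using ab by blast
  qed simp
  then show thesis using that by blast
qed

lemma arith_prog_meet:
  assumes "b \<ge> 1" "c \<ge> 1" "[z = a] (mod gcd b c)"
  shows "arith_prog a b \<inter> arith_prog z c \<noteq> {}"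
proof -
  obtain t where t: "[int c * t = int (gcd c b)] (mod int b)"
    using cong_solve_int [of "int c" "int b"] by auto
  obtain q where q: "int a - int z = int (gcd c b) * q"
    using assms(3) by (metis cong_iff_dvd_diff cong_int_iff cong_sym dvdE gcd.commute)
  \<comment> \<open>Adding \<open>b * c * N\<close> keeps both residues and moves \<open>y\<close>
    past both starting points, as the progressions extend upwards only.\<close>
  define N where "N = int (a + z) + \<bar>int c * (t * q)\<bar>"
  define y where "y = nat (int z + int c * (t * q) + int b * int c * N)"
  have N: "int b * int c * N \<ge> 1 * 1 * N"
    using assms(1,2) by (intro mult_mono) (auto simp: N_def)
  then have y: "int y = int z + int c * (t * q) + int b * int c * N"
    by (simp add: y_def N_def)
  have "int y \<ge> int z" "int y \<ge> int a" using N by (auto simp: y N_def)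
  moreover have "[int y = int z] (mod int c)"
    unfolding y cong_iff_dvd_diff by simp
  moreover have "[int y = int a] (mod int b)"
  proof -
    have "[int c * t * q = int (gcd c b) * q] (mod int b)" using t by (rule cong_scalar_right)
    then have "int b dvd int c * t * q - (int a - int z)" by (simp add: q cong_iff_dvd_diff)
    then have "int b dvd (int c * t * q - (int a - int z)) + int b * (int c * N)" by simp
    moreover have "(int c * t * q - (int a - int z)) + int b * (int c * N) = int y - int a"
      by (simp add: y algebra_simps)
    ultimately show ?thesis by (simp add: cong_iff_dvd_diff)
  qed
  ultimately have "y \<in> arith_prog a b \<inter> arith_prog z c"
    by (simp add: mem_arith_prog cong_int_iff)
  then show ?thesis by blast
qed

text \<open>A basic neighbourhood of \<open>z\<close> with modulus \<open>c\<close> meets the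
  progression iff \<open>z\<close> and \<open>a\<close> agree modulo \<open>gcd b c\<close>, and
  \<open>c\<close> is prime to \<open>z\<close>. In particular, a number divisible by all primes of
  \<open>b\<close> lies in the closure whatever \<open>a\<close> is.\<close>

lemma closure_arith_prog:
  assumes "b \<ge> 1" "z \<ge> 1"
  shows "z \<in> golomb_topology closure_of arith_prog a b \<longleftrightarrow>
    (\<forall>d. d dvd b \<longrightarrow> coprime d z \<longrightarrow> [z = a] (mod d))" (is "?L \<longleftrightarrow> ?R")
proof
  assume L: ?L
  show ?R
  proof (intro allI impI)
    fix d assume d: "d dvd b" "coprime d z"
    then have "d \<ge> 1" using assms(1) by (auto intro!: Suc_leI gr0I)
    then have "openin golomb_topology (arith_prog z d)"
      using d assms by (intro openin_arith_prog) (auto simp: coprime_commute)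
    moreover have "z \<in> arith_prog z d" by (simp add: mem_arith_prog)
    ultimately obtain y where "y \<in> arith_prog a b" "y \<in> arith_prog z d"
      using L by (auto simp: in_closure_of)
    then have "[y = a] (mod b)" "[y = z] (mod d)" by (auto simp: mem_arith_prog)
    then show "[z = a] (mod d)" using d(1) cong_dvd_modulus_nat cong_sym cong_trans by blast
  qed
next
  assume R: ?R
  show ?L
    unfolding in_closure_of
  proof (intro conjI allI impI)
    show "z \<in> topspace golomb_topology" using assms by (simp add: topspace_golomb)
  next
    fix T assume T: "z \<in> T \<and> openin golomb_topology T"
    then obtain c where c: "c \<ge> 1" "coprime z c" "arith_prog z c \<subseteq> T"
      using openin_golombE by blast
    have "coprime (gcd b c) z" using c(2) by (metis coprime_commute coprime_divisors dvd_refl gcd_dvd2)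
    then have "[z = a] (mod gcd b c)" using R by simp
    then have "arith_prog a b \<inter> arith_prog z c \<noteq> {}" using assms(1) c(1) by (intro arith_prog_meet)
    then show "\<exists>y. y \<in> arith_prog a b \<and> y \<in> T" using c(3) by blast
  qed
qed

abbreviation golomb_closure :: "nat set \<Rightarrow> nat set" where
  "golomb_closure S \<equiv> golomb_topology closure_of S"

text \<open>Closures of small neighbourhoods of two distinct points prime to \<open>p\<close> meet only in multiples
  of \<open>p\<close>.  So the condition holds for distinct points iff every prime is prime to two of them.\<close>

definition separated_triple :: "nat \<Rightarrow> nat \<Rightarrow> nat \<Rightarrow> bool" where
  "separated_triple x y z \<longleftrightarrow> (\<forall>V. openin golomb_topology V \<longrightarrow> V \<noteq> {} \<longrightarrow>
     (\<exists>A B C. openin golomb_topology A \<and> openin golomb_topology B \<and> openin golomb_topology C \<and>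
       x \<in> A \<and> y \<in> B \<and> z \<in> C \<and>
       golomb_closure A \<inter> golomb_closure B \<inter> golomb_closure C \<subseteq> golomb_closure V))"

section \<open>Separated triples and coprimality\<close>

lemma prime_to_part_exists:
  fixes b x :: nat
  assumes "b \<ge> 1" "x \<ge> 1"
  obtains B where "B \<ge> 1" "coprime x B" "\<And>p. prime p \<Longrightarrow> p dvd b \<Longrightarrow> \<not> p dvd x \<Longrightarrow> p ^ k dvd B"
proof -
  define S where "S = {p. prime p \<and> p dvd b \<and> \<not> p dvd x}"
  have fin: "finite S"
    unfolding S_def using assms(1) by (intro finite_subset [OF _ finite_divisors_nat [of b]]) auto
  define B where "B = (\<Prod>p\<in>S. p ^ k)"
  show thesis
  proof (rule that [of B])
    show "B \<ge> 1" unfolding B_def S_def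
      by (metis (no_types, lifting) One_nat_def Suc_leI mem_Collect_eq prime_gt_0_nat prod_pos zero_less_power)
    show "coprime x B" unfolding B_def
      by (intro prod_coprime_right) (auto simp: S_def coprime_commute prime_imp_coprime)
    show "p ^ k dvd B" if "prime p" "p dvd b" "\<not> p dvd x" for p
      unfolding B_def using fin that by (intro dvd_prodI) (auto simp: S_def)
  qed
qed

lemma separated_triple_coprime:
  assumes pos: "x \<ge> 1" "y \<ge> 1" "z \<ge> 1" and distinct: "x \<noteq> y" "x \<noteq> z" "y \<noteq> z"
    and cop: "coprime x y" "coprime x z" "coprime y z"
  shows "separated_triple x y z"
  unfolding separated_triple_def
proof (intro allI impI)
  fix V assume V: "openin golomb_topology V" "V \<noteq> {}"
  then obtain a where "a \<in> V" by blast
  with V(1) obtain b where b: "b \<ge> 1" "arith_prog a b \<subseteq> V" by (rule openin_golombE)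
  \<comment> \<open>Exceeds all three points, so that distinct ones stay distinct modulo
    \<open>p ^ k\<close>.\<close>
  define k where "k = x + y + z"
  obtain X where X: "X \<ge> 1" "coprime x X" "\<And>p. prime p \<Longrightarrow> p dvd b \<Longrightarrow> \<not> p dvd x \<Longrightarrow> p ^ k dvd X"
    using prime_to_part_exists [OF b(1) pos(1)] by metis
  obtain Y where Y: "Y \<ge> 1" "coprime y Y" "\<And>p. prime p \<Longrightarrow> p dvd b \<Longrightarrow> \<not> p dvd y \<Longrightarrow> p ^ k dvd Y"
    using prime_to_part_exists [OF b(1) pos(2)] by metis
  obtain Z where Z: "Z \<ge> 1" "coprime z Z" "\<And>p. prime p \<Longrightarrow> p dvd b \<Longrightarrow> \<not> p dvd z \<Longrightarrow> p ^ k dvd Z"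
    using prime_to_part_exists [OF b(1) pos(3)] by metis
  have key: "p dvd w" if uv: "w \<ge> 1" "w \<in> golomb_closure (arith_prog u U)" "w \<in> golomb_closure (arith_prog v W)"
      "U \<ge> 1" "W \<ge> 1" "p ^ k dvd U" "p ^ k dvd W" "prime p" "u \<noteq> v" "u < k" "v < k" for p u v w U W
  proof (rule ccontr)
    assume "\<not> p dvd w"
    then have "coprime (p ^ k) w" using uv by (simp add: prime_imp_coprime)
    then have "[w = u] (mod p ^ k)" "[w = v] (mod p ^ k)"
      using uv closure_arith_prog by blast+
    then have "[u = v] (mod p ^ k)" using cong_sym cong_trans by blast
    moreover have "k < p ^ k" using power_gt_expt [of p k] prime_gt_1_nat [OF uv(8)] by simp
    ultimately show False using uv by (auto dest!: cong_less_modulus_unique_nat)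
  qed
  have "w \<in> golomb_closure V" if w: "w \<in> golomb_closure (arith_prog x X)"
    "w \<in> golomb_closure (arith_prog y Y)" "w \<in> golomb_closure (arith_prog z Z)" for w
  proof -
    have "w \<in> topspace golomb_topology" using w(1) closure_of_subset_topspace [of golomb_topology] by blast
    then have w1: "w \<ge> 1" by (simp add: topspace_golomb)
    have k: "x < k" "y < k" "z < k" using pos by (auto simp: k_def)
    have dvd: "p dvd w" if p: "prime p" "p dvd b" for p
    proof -
      consider "\<not> p dvd x" "\<not> p dvd y" | "\<not> p dvd x" "\<not> p dvd z" | "\<not> p dvd y" "\<not> p dvd z"
        using cop p(1) by (meson coprime_common_divisor not_prime_unit)
      then show ?thesis
      proof cases
        case 1
        then show ?thesis using key [OF w1 w(1,2) X(1) Y(1)] X(3) Y(3) p distinct(1) k by blast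
      next
        case 2
        then show ?thesis using key [OF w1 w(1,3) X(1) Z(1)] X(3) Z(3) p distinct(2) k by blast
      next
        case 3
        then show ?thesis using key [OF w1 w(2,3) Y(1) Z(1)] Y(3) Z(3) p distinct(3) k by blast
      qed
    qed
    \<comment> \<open>All primes of \<open>b\<close> divide \<open>w\<close>, so 1 is the only
      divisor of \<open>b\<close> prime to \<open>w\<close>.\<close>
    have "[w = a] (mod d)" if d: "d dvd b" "coprime d w" for d
    proof -
      have "d = 1"
      proof (rule ccontr)
        assume "d \<noteq> 1"
        then obtain p where p: "prime p" "p dvd d" using prime_factor_nat by blast
        then have "p dvd w" using dvd d(1) dvd_trans by blast
        then show False using p d(2) by (meson coprime_common_divisor not_prime_unit)
      qed
      then show ?thesis by simp
    qed
    then have "w \<in> golomb_closure (arith_prog a b)" using closure_arith_prog [OF b(1) w1] by blast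
    then show ?thesis using closure_of_mono [OF b(2)] by blast
  qed
  then show "\<exists>A B C. openin golomb_topology A \<and> openin golomb_topology B \<and> openin golomb_topology C \<and>
       x \<in> A \<and> y \<in> B \<and> z \<in> C \<and>
       golomb_closure A \<inter> golomb_closure B \<inter> golomb_closure C \<subseteq> golomb_closure V"
    using openin_arith_prog [OF pos(1) X(1,2)] openin_arith_prog [OF pos(2) Y(1,2)]
      openin_arith_prog [OF pos(3) Z(1,2)]
    by (intro exI [of _ "arith_prog x X"] exI [of _ "arith_prog y Y"] exI [of _ "arith_prog z Z"])
      (auto simp: mem_arith_prog)
qed

text \<open>If \<open>p\<close> divides \<open>x\<close> and \<open>y\<close>, the moduli of their
  neighbourhoods are prime to \<open>p\<close>, and every positive common multiple of these moduli
  lies in both closures. Its residue modulo powers of \<open>p\<close> is then free to match that of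
  \<open>z\<close> and to miss a chosen open set.\<close>

lemma separated_triple_imp_coprime:
  assumes pos: "x \<ge> 1" "y \<ge> 1" "z \<ge> 1" and sep: "separated_triple x y z"
  shows "coprime x y"
proof (rule ccontr)
  assume "\<not> coprime x y"
  then obtain c where c: "c dvd x" "c dvd y" "\<not> is_unit c" by (rule not_coprimeE)
  then have "c \<noteq> 1" by auto
  then obtain p where "prime p" "p dvd c" using prime_factor_nat by blast
  then have p: "prime p" "p dvd x" "p dvd y" using c dvd_trans by auto
  have p2: "p > 1" using p prime_gt_1_nat by blast
  \<comment> \<open>If \<open>p\<close> divides \<open>z\<close>, then the modulus \<open>Z\<close>
    is prime to \<open>p\<close> too, and any residue prime to \<open>p\<close> will do.\<close>
  define z' where "z' = (if p dvd z then 1 else z)"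
  have z': "\<not> p dvd z'" "z' \<ge> 1" using p2 pos(3) by (auto simp: z'_def)
  \<comment> \<open>The closure must exclude the residue of \<open>z'\<close> while \<open>v\<close>
    stays prime to \<open>p\<close>. Modulo 2 there is only one odd class, hence the modulus
    \<open>p\<^sup>2\<close>.\<close>
  define v where "v = z' + p"
  have "\<not> p dvd v" using z'(1) by (simp add: v_def)
  then have "coprime v (p\<^sup>2)" using p(1) by (simp add: coprime_commute prime_imp_coprime)
  moreover have "v \<ge> 1" "p\<^sup>2 \<ge> 1" using z' p2 by (auto simp: v_def)
  ultimately have "openin golomb_topology (arith_prog v (p\<^sup>2))" by (intro openin_arith_prog)
  moreover have "arith_prog v (p\<^sup>2) \<noteq> {}" using mem_arith_prog [of v v "p\<^sup>2"] by auto
  ultimately obtain A B C where ABC: "openin golomb_topology A" "openin golomb_topology B" "openin golomb_topology C"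
      "x \<in> A" "y \<in> B" "z \<in> C"
    and sub: "golomb_closure A \<inter> golomb_closure B \<inter> golomb_closure C \<subseteq> golomb_closure (arith_prog v (p\<^sup>2))"
    using sep unfolding separated_triple_def by meson
  obtain X where X: "X \<ge> 1" "coprime x X" "arith_prog x X \<subseteq> A" using ABC openin_golombE by metis
  obtain Y where Y: "Y \<ge> 1" "coprime y Y" "arith_prog y Y \<subseteq> B" using ABC openin_golombE by metis
  obtain Z where Z: "Z \<ge> 1" "coprime z Z" "arith_prog z Z \<subseteq> C" using ABC openin_golombE by metis
  have unit: "\<not> is_unit p" "Z \<noteq> 0" using p(1) Z(1) not_prime_unit by auto
  obtain j R where R: "Z = p ^ j * R" "\<not> p dvd R"
    using multiplicity_decompose' [OF unit(2,1)] by metis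
  define k where "k = j + 2"
  have pX: "\<not> p dvd X" using p X(2) by (meson coprime_common_divisor not_prime_unit)
  have pY: "\<not> p dvd Y" using p Y(2) by (meson coprime_common_divisor not_prime_unit)
  have "\<not> p dvd X * Y * R" using pX pY R(2) p(1) by (simp add: prime_dvd_mult_iff)
  then have "coprime p (X * Y * R)" using p(1) prime_imp_coprime by blast
  then have "coprime (p ^ k) (X * Y * R)" by simp
  then obtain w where w: "[w = z'] (mod p ^ k)" "[w = 0] (mod X * Y * R)"
    using binary_chinese_remainder_nat by blast
  have XYR: "X dvd w" "Y dvd w" "R dvd w"
    using w(2) by (auto simp: cong_0_iff elim: dvd_mult_left dvd_mult_right)
  have wp: "[w = z'] (mod p)" using cong_prime_power_le [OF w(1), of 1] by (simp add: k_def)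
  then have pw: "\<not> p dvd w" using z'(1) cong_dvd_iff by blast
  then have w1: "w \<ge> 1" by (cases w) auto
  have wXY: "w \<in> golomb_closure (arith_prog x X)" "w \<in> golomb_closure (arith_prog y Y)"
  proof -
    have one: "[w = u] (mod d)" if "d dvd W" "W dvd w" "coprime d w" for d u W
    proof -
      have "d dvd w" using that dvd_trans by blast
      then have "d = 1" using that(3) by (simp add: coprime_absorb_left)
      then show ?thesis by simp
    qed
    show "w \<in> golomb_closure (arith_prog x X)" "w \<in> golomb_closure (arith_prog y Y)"
      unfolding closure_arith_prog [OF X(1) w1] closure_arith_prog [OF Y(1) w1]
      using one XYR by blast+
  qed
  have wZ: "w \<in> golomb_closure (arith_prog z Z)"
    unfolding closure_arith_prog [OF Z(1) w1]
  proof (intro allI impI)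
    fix d assume d: "d dvd Z" "coprime d w"
    have "coprime d R" using d(2) XYR(3) by (meson coprime_divisors dvd_refl)
    then have dp: "d dvd p ^ j" using d(1) coprime_dvd_mult_left_iff unfolding R(1) by blast
    show "[w = z] (mod d)"
    proof (cases "p dvd z")
      case True
      then have "\<not> p dvd Z" using Z(2) p(1) by (meson coprime_common_divisor not_prime_unit)
      then have "j = 0" using R(1) by (cases j) auto
      then show ?thesis using dp by simp
    next
      case False
      then have "z' = z" by (simp add: z'_def)
      moreover have "d dvd p ^ k" using dp by (simp add: k_def power_add)
      ultimately show ?thesis using w(1) cong_dvd_modulus_nat by blast
    qed
  qed
  have "w \<in> golomb_closure A" "w \<in> golomb_closure B" "w \<in> golomb_closure C"
    using subsetD [OF closure_of_mono [OF X(3)] wXY(1)] subsetD [OF closure_of_mono [OF Y(3)] wXY(2)]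
      subsetD [OF closure_of_mono [OF Z(3)] wZ] by simp_all
  then have "w \<in> golomb_closure (arith_prog v (p\<^sup>2))" using sub by auto
  then have "\<forall>d. d dvd p\<^sup>2 \<longrightarrow> coprime d w \<longrightarrow> [w = v] (mod d)"
    by (simp only: closure_arith_prog [OF \<open>p\<^sup>2 \<ge> 1\<close> w1])
  moreover have "coprime (p\<^sup>2) w" using pw p(1) by (simp add: prime_imp_coprime)
  ultimately have wv: "[w = v] (mod p\<^sup>2)" by simp
  have wz': "[w = z'] (mod p\<^sup>2)" using cong_prime_power_le [OF w(1), of 2] by (simp add: k_def)
  have "[z' + p = z' + 0] (mod p\<^sup>2)"
    using cong_trans [OF cong_sym [OF wv] wz'] by (simp add: v_def)
  then have "p\<^sup>2 dvd p" by (simp only: cong_add_lcancel_nat cong_0_iff)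
  then have "p\<^sup>2 \<le> p" using p2 by (intro dvd_imp_le) auto
  then show False using p2 by (simp add: power2_eq_square)
qed

section \<open>Homeomorphisms of the Golomb space\<close>

text \<open>Fixing the inverse as well lets each result be applied with the roles of
  \<open>h\<close> and \<open>k\<close> exchanged, through \<open>inverse_homeo\<close>.\<close>

locale golomb_homeo =
  fixes h k :: "nat \<Rightarrow> nat"
  assumes homeo: "homeomorphic_maps golomb_topology golomb_topology h k"
begin

lemma continuous: "continuous_map golomb_topology golomb_topology h" "continuous_map golomb_topology golomb_topology k"
  and k_h: "x \<ge> 1 \<Longrightarrow> k (h x) = x" and h_k: "x \<ge> 1 \<Longrightarrow> h (k x) = x"
  using homeo unfolding homeomorphic_maps_def topspace_golomb by simp_all

lemma h_pos: "x \<ge> 1 \<Longrightarrow> h x \<ge> 1" and k_pos: "x \<ge> 1 \<Longrightarrow> k x \<ge> 1"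
  using continuous_map_funspace [OF continuous(1)] continuous_map_funspace [OF continuous(2)]
  unfolding topspace_golomb by (simp_all add: Pi_iff)

lemmas pos_simps = h_pos k_pos h_pos [unfolded One_nat_def] k_pos [unfolded One_nat_def]

lemma h_inj:
  assumes "x \<ge> 1" "y \<ge> 1"
  shows "h x = h y \<longleftrightarrow> x = y"
proof
  assume "h x = h y"
  then have "k (h x) = k (h y)" by simp
  then show "x = y" by (simp only: k_h assms)
qed simp

lemma inverse_homeo: "golomb_homeo k h"
  by unfold_locales (rule iffD1 [OF homeomorphic_maps_sym homeo])

lemma openin_vimage:
  "openin golomb_topology V \<Longrightarrow> openin golomb_topology {x \<in> {1..}. h x \<in> V}"
  "openin golomb_topology V \<Longrightarrow> openin golomb_topology {x \<in> {1..}. k x \<in> V}"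
  using openin_continuous_map_preimage [OF continuous(1)] openin_continuous_map_preimage [OF continuous(2)]
  by (simp_all only: topspace_golomb)

lemma closure_vimage_h:
  assumes "w \<in> golomb_closure {x \<in> {1..}. h x \<in> V}"
  shows "h w \<in> golomb_closure V"
proof -
  have "h w \<in> golomb_closure (h ` {x \<in> {1..}. h x \<in> V})"
    using continuous_map_image_closure_subset [OF continuous(1)] assms by blast
  moreover have "golomb_closure (h ` {x \<in> {1..}. h x \<in> V}) \<subseteq> golomb_closure V"
    by (rule closure_of_mono) auto
  ultimately show ?thesis by auto
qed

lemma closure_vimage_k:
  assumes "w \<in> golomb_closure {x \<in> {1..}. k x \<in> V}"
  shows "k w \<in> golomb_closure V"
  using golomb_homeo.closure_vimage_h [OF inverse_homeo assms] .

lemma separated_triple_h: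
  assumes "x \<ge> 1" "y \<ge> 1" "z \<ge> 1" "separated_triple x y z"
  shows "separated_triple (h x) (h y) (h z)"
  unfolding separated_triple_def
proof (intro allI impI)
  fix V assume V: "openin golomb_topology V" "V \<noteq> {}"
  let ?V = "{x \<in> {1..}. h x \<in> V}"
  obtain v where "v \<in> V" using V by blast
  moreover have "v \<ge> 1" using openin_subset [OF V(1)] \<open>v \<in> V\<close> by (auto simp: topspace_golomb)
  ultimately have "k v \<in> ?V" by (simp add: h_k pos_simps)
  then obtain A B C where ABC: "openin golomb_topology A" "openin golomb_topology B" "openin golomb_topology C"
       "x \<in> A" "y \<in> B" "z \<in> C"
    and sub: "golomb_closure A \<inter> golomb_closure B \<inter> golomb_closure C \<subseteq> golomb_closure ?V"
    using assms(4) openin_vimage(1) [OF V(1)] unfolding separated_triple_def by (metis (lifting) empty_iff)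
  have "w \<in> golomb_closure V" if w: "w \<in> golomb_closure {x \<in> {1..}. k x \<in> A}"
    "w \<in> golomb_closure {x \<in> {1..}. k x \<in> B}" "w \<in> golomb_closure {x \<in> {1..}. k x \<in> C}" for w
  proof -
    have "w \<ge> 1" using w(1) closure_of_subset_topspace [of golomb_topology] by (auto simp: topspace_golomb)
    have "k w \<in> golomb_closure ?V" using w closure_vimage_k sub by blast
    then have "h (k w) \<in> golomb_closure V" by (rule closure_vimage_h)
    then show ?thesis using \<open>w \<ge> 1\<close> by (simp add: h_k)
  qed
  then show "\<exists>A B C. openin golomb_topology A \<and> openin golomb_topology B \<and> openin golomb_topology C \<and>
       h x \<in> A \<and> h y \<in> B \<and> h z \<in> C \<and>
       golomb_closure A \<inter> golomb_closure B \<inter> golomb_closure C \<subseteq> golomb_closure V"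
    using openin_vimage(2) [OF ABC(1)] openin_vimage(2) [OF ABC(2)] openin_vimage(2) [OF ABC(3)] ABC(4-6) assms(1-3)
    by (intro exI [of _ "{x \<in> {1..}. k x \<in> A}"] exI [of _ "{x \<in> {1..}. k x \<in> B}"]
        exI [of _ "{x \<in> {1..}. k x \<in> C}"]) (auto simp: k_h pos_simps)
qed

section \<open>Coprimality and the induced permutation of the primes\<close>

lemma coprime_imp:
  assumes "x \<ge> 1" "y \<ge> 1" "x \<noteq> y" "coprime x y"
  shows "coprime (h x) (h y)"
proof -
  \<comment> \<open>The criterion concerns triples; a large prime serves as a third point coprime to
    both.\<close>
  obtain p where p: "prime p" "p > x + y" using bigger_prime by blast
  have "\<not> p dvd x" "\<not> p dvd y" using p assms by (auto dest: dvd_imp_le)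
  then have "coprime x p" "coprime y p" using p(1) by (auto simp: coprime_commute prime_imp_coprime)
  then have "separated_triple x y p"
    using assms p by (intro separated_triple_coprime) auto
  moreover have "p \<ge> 1" using p by simp
  ultimately have "separated_triple (h x) (h y) (h p)" using assms by (intro separated_triple_h)
  then show ?thesis using assms p h_pos by (intro separated_triple_imp_coprime [of _ _ "h p"]) auto
qed

lemma coprime_iff:
  assumes "x \<ge> 1" "y \<ge> 1" "x \<noteq> y"
  shows "coprime (h x) (h y) \<longleftrightarrow> coprime x y"
proof
  assume "coprime (h x) (h y)"
  moreover have "h x \<noteq> h y" using assms h_inj by blast
  ultimately have "coprime (k (h x)) (k (h y))"
    using assms h_pos by (intro golomb_homeo.coprime_imp [OF inverse_homeo]) auto
  then show "coprime x y" using assms by (simp add: k_h)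
qed (use assms coprime_imp in blast)

text \<open>The number 1 is coprime to all others, but unless \<open>h 1\<close> is 1, the different
  number \<open>2 * h 1\<close> shares a factor with it.\<close>

lemma h_1: "h 1 = 1"
proof (rule ccontr)
  assume 1: "h 1 \<noteq> 1"
  define y where "y = k (2 * h 1)"
  have y: "y \<ge> 1" "h y = 2 * h 1" using h_pos [of 1] by (auto simp: y_def pos_simps h_k)
  have "y \<noteq> 1" using y h_pos [of 1] by auto
  then have "coprime (h 1) (h y)" using coprime_imp [of 1 y] y by simp
  then show False using y(2) 1 by simp
qed

text \<open>Two distinct primes dividing \<open>h p\<close> would have coprime preimages, yet
  \<open>p\<close> divides both. So \<open>h p\<close> has a single prime factor \<open>q\<close>,
  and divisibility by \<open>q\<close> is failure of coprimality with \<open>h p\<close>.\<close>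

lemma ex_prime_image:
  assumes "prime p"
  shows "\<exists>q. prime q \<and> (\<forall>z\<ge>1. p dvd z \<longleftrightarrow> q dvd h z)"
proof -
  have p1: "p > 1" using assms prime_gt_1_nat by blast
  define u where "u = h p"
  have u1: "u \<ge> 1" using h_pos p1 by (simp add: u_def)
  have "u \<noteq> 1" using h_inj [of p 1] h_1 p1 by (simp add: u_def)
  then obtain q where q: "prime q" "q dvd u" using prime_factor_nat by blast
  have pk: "p dvd k r" if r: "prime r" "r dvd u" for r
  proof (cases "k r = p")
    case False
    have r1: "r \<ge> 1" using r by (simp add: prime_gt_0_nat Suc_leI)
    have "\<not> coprime r u" using r by (meson coprime_common_divisor dvd_refl not_prime_unit)
    then have "\<not> coprime (h (k r)) (h p)" using r1 by (simp add: h_k u_def)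
    then have "\<not> coprime (k r) p" using coprime_iff [of "k r" p] False k_pos [OF r1] p1 by simp
    then show ?thesis using assms by (metis coprime_commute prime_imp_coprime)
  qed simp
  have uniq: "r = q" if r: "prime r" "r dvd u" for r
  proof (rule ccontr)
    assume "r \<noteq> q"
    then have "coprime r q" using r q primes_coprime by blast
    have r1: "r \<ge> 1" "q \<ge> 1" using r q by (simp_all add: prime_gt_0_nat Suc_leI)
    have "k r \<noteq> k q" using \<open>r \<noteq> q\<close> h_k [OF r1(1)] h_k [OF r1(2)] by auto
    then have "coprime (k r) (k q)"
      using coprime_iff [of "k r" "k q"] \<open>coprime r q\<close> r1 by (simp add: pos_simps h_k)
    then show False using pk [OF r] pk [OF q] assms by (meson coprime_common_divisor not_prime_unit)
  qed
  have "p dvd z \<longleftrightarrow> q dvd h z" if "z \<ge> 1" for z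
  proof (cases "z = p")
    case True
    then show ?thesis using q by (simp add: u_def)
  next
    case False
    have "p dvd z \<longleftrightarrow> \<not> coprime p z"
      using assms by (meson coprime_common_divisor dvd_refl not_prime_unit prime_imp_coprime)
    also have "\<dots> \<longleftrightarrow> \<not> coprime u (h z)"
      using coprime_iff [of p z] False that p1 by (simp add: u_def)
    also have "\<dots> \<longleftrightarrow> q dvd h z"
    proof
      assume "\<not> coprime u (h z)"
      then obtain c where c: "c dvd u" "c dvd h z" "\<not> is_unit c" by (rule not_coprimeE)
      then have "c \<noteq> 1" by auto
      then obtain r where "prime r" "r dvd c" using prime_factor_nat by blast
      then show "q dvd h z" using c uniq dvd_trans by metis
    next
      assume "q dvd h z"
      then show "\<not> coprime u (h z)" using q by (meson coprime_common_divisor not_prime_unit)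
    qed
    finally show ?thesis .
  qed
  with q show ?thesis by blast
qed

definition \<sigma> :: "nat \<Rightarrow> nat" where
  "\<sigma> p = (SOME q. prime q \<and> (\<forall>z\<ge>1. p dvd z \<longleftrightarrow> q dvd h z))"

lemma \<sigma>:
  assumes "prime p"
  shows "prime (\<sigma> p)" "z \<ge> 1 \<Longrightarrow> \<sigma> p dvd h z \<longleftrightarrow> p dvd z"
  using someI_ex [OF ex_prime_image [OF assms]] unfolding \<sigma>_def by auto

lemma \<sigma>_eqI:
  assumes "prime p" "prime q" "\<And>z. z \<ge> 1 \<Longrightarrow> p dvd z \<longleftrightarrow> q dvd h z"
  shows "\<sigma> p = q"
proof -
  have q1: "q \<ge> 1" using assms(2) by (simp add: prime_gt_0_nat Suc_leI)
  have "p dvd k q" using assms(3) [of "k q"] q1 by (simp add: pos_simps h_k)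
  then have "\<sigma> p dvd h (k q)" using \<sigma>(2) [OF assms(1), of "k q"] q1 by (simp add: pos_simps)
  then have "\<sigma> p dvd q" using q1 by (simp add: h_k)
  then show ?thesis using \<sigma>(1) [OF assms(1)] assms(2) primes_dvd_imp_eq by blast
qed

lemma \<sigma>_inverse:
  assumes "prime p"
  shows "golomb_homeo.\<sigma> k (\<sigma> p) = p"
proof (rule golomb_homeo.\<sigma>_eqI [OF inverse_homeo \<sigma>(1) [OF assms] assms])
  fix z :: nat assume "z \<ge> 1"
  then show "\<sigma> p dvd z \<longleftrightarrow> p dvd k z" using \<sigma>(2) [OF assms, of "k z"] by (simp add: pos_simps h_k)
qed

lemma \<sigma>_inj: "prime p \<Longrightarrow> prime q \<Longrightarrow> \<sigma> p = \<sigma> q \<longleftrightarrow> p = q"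
  by (metis \<sigma>_inverse)

lemma \<sigma>_surj:
  assumes "prime q"
  obtains p where "prime p" "\<sigma> p = q"
  using golomb_homeo.\<sigma>(1) [OF inverse_homeo assms] golomb_homeo.\<sigma>_inverse [OF inverse_homeo assms]
  by blast

lemma \<sigma>_fixed: "prime p \<Longrightarrow> h p = p \<Longrightarrow> \<sigma> p = p"
  using \<sigma>(1) [of p] \<sigma>(2) [of p p] primes_dvd_imp_eq [of "\<sigma> p" p] by (simp add: prime_gt_0_nat Suc_leI)

text \<open>A Golomb neighbourhood of \<open>x\<close> also restricts residues at primes other than
  \<open>l\<close>. Its closure puts no such restriction on multiples of the part \<open>r\<close>
  of the modulus prime to \<open>l\<close>, and \<open>h\<close> maps closures into
  closures.\<close>

lemma padic_continuous_on_multiples: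
  assumes l: "prime l" and x: "x \<ge> 1" "\<not> l dvd x"
  obtains n r where "n \<ge> 1" "\<not> l dvd r"
    "\<And>z. \<lbrakk>z \<ge> 1; [z = x] (mod l ^ n); r dvd z\<rbrakk> \<Longrightarrow> [h z = h x] (mod \<sigma> l ^ m)"
proof -
  have q: "prime (\<sigma> l)" "\<not> \<sigma> l dvd h x" using \<sigma> [OF l] x by auto
  have q1: "\<sigma> l ^ m \<ge> 1" using q by (simp add: prime_gt_0_nat Suc_leI)
  have "coprime (\<sigma> l) (h x)" using q prime_imp_coprime by blast
  then have "openin golomb_topology (arith_prog (h x) (\<sigma> l ^ m))"
    using q1 h_pos [OF x(1)] by (intro openin_arith_prog) (auto simp: coprime_commute)
  then have "openin golomb_topology {y \<in> {1..}. h y \<in> arith_prog (h x) (\<sigma> l ^ m)}" (is "openin _ ?U")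
    by (rule openin_vimage)
  moreover have "x \<in> ?U" using x by (simp add: mem_arith_prog)
  ultimately obtain b where b: "b \<ge> 1" "coprime x b" "arith_prog x b \<subseteq> ?U" by (rule openin_golombE)
  have "\<not> is_unit l" "b \<noteq> 0" using l b not_prime_unit by auto
  then obtain n r where n: "b = l ^ n * r" "\<not> l dvd r" using multiplicity_decompose' by metis
  show thesis
  \<comment> \<open>The exponent is made positive, so that \<open>z\<close> is prime to
    \<open>l\<close> even if \<open>l\<close> does not divide \<open>b\<close>.\<close>
  proof (rule that [of "Suc n" r])
    fix z assume z: "z \<ge> 1" "[z = x] (mod l ^ Suc n)" "r dvd z"
    have zn: "[z = x] (mod l ^ n)" using cong_prime_power_le [OF z(2)] by simp
    have "[z = x] (mod l)" using cong_prime_power_le [OF z(2), of 1] by simp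
    then have "\<not> l dvd z" using x(2) cong_dvd_iff by blast
    then have "\<not> \<sigma> l dvd h z" using \<sigma>(2) [OF l z(1)] by simp
    then have cop: "coprime (\<sigma> l ^ m) (h z)" using q(1) by (simp add: prime_imp_coprime)
    have "[z = x] (mod d)" if d: "d dvd b" "coprime d z" for d
    proof -
      have "coprime d r" using d(2) z(3) by (meson coprime_divisors dvd_refl)
      then have "d dvd l ^ n" using d(1) coprime_dvd_mult_left_iff unfolding n(1) by blast
      then show ?thesis using zn cong_dvd_modulus_nat by blast
    qed
    then have "z \<in> golomb_closure (arith_prog x b)" by (simp add: closure_arith_prog [OF b(1) z(1)])
    then have "z \<in> golomb_closure ?U" using closure_of_mono [OF b(3)] by (rule subsetD [rotated])
    then have "h z \<in> golomb_closure (arith_prog (h x) (\<sigma> l ^ m))" by (rule closure_vimage_h)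
    then have "\<forall>d. d dvd \<sigma> l ^ m \<longrightarrow> coprime d (h z) \<longrightarrow> [h z = h x] (mod d)"
      by (simp only: closure_arith_prog [OF q1 h_pos [OF z(1)]])
    then show "[h z = h x] (mod \<sigma> l ^ m)" using cop by simp
  qed (use n in auto)
qed

text \<open>A point close to both \<open>x\<close> and \<open>y\<close> in the \<open>l\<close>-adic sense, but divisible by the moduli prime
  to \<open>l\<close>, transfers Golomb continuity to \<open>l\<close>-adic continuity.\<close>

lemma padic_continuous:
  assumes l: "prime l" and x: "x \<ge> 1" "\<not> l dvd x"
  obtains n where "\<And>y. \<lbrakk>y \<ge> 1; [y = x] (mod l ^ n)\<rbrakk> \<Longrightarrow> [h y = h x] (mod \<sigma> l ^ m)"
proof -
  obtain n r where n: "n \<ge> 1" "\<not> l dvd r"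
    "\<And>z. \<lbrakk>z \<ge> 1; [z = x] (mod l ^ n); r dvd z\<rbrakk> \<Longrightarrow> [h z = h x] (mod \<sigma> l ^ m)"
    using padic_continuous_on_multiples [OF l x, of m] by blast
  show thesis
  proof (rule that [of n])
    fix y assume y: "y \<ge> 1" "[y = x] (mod l ^ n)"
    then have "[y = x] (mod l)" using cong_prime_power_le [OF y(2), of 1] n(1) by simp
    then have ly: "\<not> l dvd y" using x(2) cong_dvd_iff by blast
    obtain n' r' where n': "n' \<ge> 1" "\<not> l dvd r'"
      "\<And>z. \<lbrakk>z \<ge> 1; [z = y] (mod l ^ n'); r' dvd z\<rbrakk> \<Longrightarrow> [h z = h y] (mod \<sigma> l ^ m)"
      using padic_continuous_on_multiples [OF l y(1) ly, of m] by blast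
    have "\<not> l dvd r * r'" using n(2) n'(2) l by (simp add: prime_dvd_mult_iff)
    then have "coprime l (r * r')" using l prime_imp_coprime by blast
    then have "coprime (l ^ (n + n')) (r * r')" by simp
    then obtain z where z: "[z = y] (mod l ^ (n + n'))" "[z = 0] (mod r * r')"
      using binary_chinese_remainder_nat by blast
    have zr: "r dvd z" "r' dvd z" using z(2) by (auto simp: cong_0_iff elim: dvd_mult_left dvd_mult_right)
    have "[z = y] (mod l)" using cong_prime_power_le [OF z(1), of 1] n(1) by simp
    then have "\<not> l dvd z" using ly cong_dvd_iff by blast
    then have z1: "z \<ge> 1" by (cases z) auto
    have "[z = y] (mod l ^ n)" "[z = y] (mod l ^ n')" using cong_prime_power_le [OF z(1)] by simp_all
    then have "[h z = h x] (mod \<sigma> l ^ m)" "[h z = h y] (mod \<sigma> l ^ m)"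
      using n(3) [OF z1 _ zr(1)] n'(3) [OF z1 _ zr(2)] y(2) cong_trans by blast+
    then show "[h y = h x] (mod \<sigma> l ^ m)" using cong_sym cong_trans by blast
  qed
qed

end

section \<open>Divisibility by prime powers and residues modulo 8\<close>

lemma prime_power_if_unique_prime_factor:
  fixes N q :: nat
  assumes "N > 1" "prime q" "\<And>r. prime r \<Longrightarrow> r dvd N \<Longrightarrow> r = q"
  obtains j where "j \<ge> 1" "N = q ^ j"
proof -
  have "\<not> is_unit q" "N \<noteq> 0" using assms not_prime_unit by auto
  then obtain j R where R: "N = q ^ j * R" "\<not> q dvd R" using multiplicity_decompose' by metis
  have "R = 1"
  proof (rule ccontr)
    assume "R \<noteq> 1"
    then obtain r where "prime r" "r dvd R" using prime_factor_nat by blast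
    then show False using assms(3) [of r] R by simp
  qed
  then have "N = q ^ j" using R by simp
  moreover have "j \<ge> 1" using calculation assms(1) by (cases j) auto
  ultimately show thesis using that by blast
qed

lemma cong_1_iff_dvd: "x \<ge> 1 \<Longrightarrow> [x = 1] (mod n) \<longleftrightarrow> n dvd x - (1::nat)"
  using cong_altdef_nat [of 1 x n] by simp

lemma dvd_if_prime_powers_dvd:
  fixes N M :: nat
  assumes "N > 0" "\<And>p j. prime p \<Longrightarrow> j \<ge> 1 \<Longrightarrow> p ^ j dvd N \<Longrightarrow> p ^ j dvd M"
  shows "N dvd M"
proof (cases "M = 0")
  case False
  show ?thesis
  proof (rule multiplicity_le_imp_dvd)
    fix p :: nat assume p: "prime p"
    have "p ^ multiplicity p N dvd M"
      using assms(2) [OF p _ multiplicity_dvd [of p N]] by (cases "multiplicity p N = 0") auto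
    then show "multiplicity p N \<le> multiplicity p M"
      using False p by (intro multiplicity_geI) (auto simp: not_prime_unit)
  qed (use assms in simp)
qed simp

lemma power_closure_cong_1:
  assumes "power_closure l s x" "[s = 1] (mod l ^ j)"
  shows "[x = 1] (mod l ^ j)"
proof -
  obtain i where "[x = s ^ i] (mod l ^ j)" using assms(1) unfolding power_closure_def by blast
  moreover have "[s ^ i = 1 ^ i] (mod l ^ j)" using assms(2) by (rule cong_pow)
  ultimately show ?thesis using cong_trans by fastforce
qed

lemma odd_power_mod_8:
  fixes c :: nat
  assumes "odd c"
  shows "[c ^ i = (if even i then 1 else c)] (mod 8)"
proof -
  have "c mod 8 \<in> {1, 3, 5, 7}" using assms by auto presburger
  then have "(c mod 8)\<^sup>2 mod 8 = 1" by auto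
  then have sq: "[c\<^sup>2 = 1] (mod 8)" by (simp add: Cong.cong_def power_mod)
  have even: "[c ^ (2 * j) = 1] (mod 8)" for j
    using cong_pow [OF sq, of j] by (simp add: power_mult)
  show ?thesis
  proof (cases "even i")
    case True
    then show ?thesis using even by (auto elim: evenE)
  next
    case False
    then obtain j where "i = 2 * j + 1" by (elim oddE)
    then show ?thesis using cong_scalar_left [OF even [of j], of c] False by simp
  qed
qed

text \<open>If \<open>b\<close> is not a square modulo 8, then only odd powers of \<open>c\<close> approximate \<open>b\<close>, and odd powers
  can be inverted in the 2-group of units modulo \<open>2 ^ m\<close>.\<close>

lemma power_closure_2_sym:
  assumes "odd c" "power_closure 2 c b" "[b \<noteq> 1] (mod 8)"
  shows "power_closure 2 b c"
  unfolding power_closure_def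
proof
  fix m :: nat
  define M where "M = m + 3"
  obtain i where i: "[b = c ^ i] (mod 2 ^ M)" using assms(2) unfolding power_closure_def by blast
  have "[b = c ^ i] (mod 2 ^ 3)" using cong_prime_power_le [OF i, of 3] by (simp only: M_def le_add2)
  then have i8: "[b = c ^ i] (mod 8)" by simp
  have "odd i"
  proof
    assume "even i"
    then have "[c ^ i = 1] (mod 8)" using odd_power_mod_8 [OF assms(1), of i] by simp
    then show False using assms(3) cong_trans [OF i8] by blast
  qed
  then have "coprime i (2 ^ M)" by simp
  then obtain x where x: "[i * x = 1] (mod 2 ^ M)"
    using cong_solve_coprime_nat [of i "2 ^ M"] unfolding One_nat_def by blast
  define t where "t = x + 2 ^ M"
  have "[i * t = i * x + 0] (mod 2 ^ M)"
    unfolding t_def distrib_left by (intro cong_add) (auto simp: cong_0_iff)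
  then have it: "[i * t = 1] (mod 2 ^ M)" using x cong_trans by fastforce
  have "[c = 1] (mod 2)" using assms(1) by (simp add: Cong.cong_def odd_iff_mod_2_eq_one)
  then have "[c ^ 2 ^ M = 1] (mod 2 ^ M)" by (rule cong_1_power_prime_power [OF two_is_prime_nat])
  then have "ord (2 ^ M) c dvd 2 ^ M" using ord_divides by blast
  then have "[i * t = 1] (mod ord (2 ^ M) c)" using it cong_dvd_modulus_nat by blast
  moreover have "coprime (2 ^ M) c" using assms(1) by simp
  ultimately have "[c ^ (i * t) = c ^ 1] (mod 2 ^ M)" using order_divides_expdiff by blast
  moreover have "[b ^ t = (c ^ i) ^ t] (mod 2 ^ M)" using i by (rule cong_pow)
  ultimately have "[b ^ t = c] (mod 2 ^ M)" using cong_trans by (simp add: power_mult) blast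
  then have "[c = b ^ t] (mod 2 ^ M)" by (rule cong_sym)
  then have "[c = b ^ t] (mod 2 ^ m)" using cong_prime_power_le by (simp add: M_def)
  moreover have "t \<ge> 1" by (simp add: t_def Suc_le_eq)
  ultimately show "\<exists>i\<ge>1. [c = b ^ i] (mod 2 ^ m)" by blast
qed

lemma odd_prime: "prime (p::nat) \<Longrightarrow> p \<noteq> 2 \<Longrightarrow> odd p"
  using primes_dvd_imp_eq [OF two_is_prime_nat] by blast

context golomb_homeo
begin

section \<open>Transport of closed subgroups and chains\<close>

lemma h_prime_power:
  assumes "prime b" "i \<ge> 1"
  obtains j where "j \<ge> 1" "h (b ^ i) = \<sigma> b ^ j"
proof -
  have b: "b ^ i > 1" using one_less_power [OF prime_gt_1_nat [OF assms(1)]] assms(2) by simp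
  have "h (b ^ i) \<noteq> 1" using h_inj [of "b ^ i" 1] b unfolding h_1 by linarith
  moreover have "h (b ^ i) \<ge> 1" using b by (intro h_pos) simp
  ultimately have "h (b ^ i) > 1" by simp
  moreover have "r = \<sigma> b" if r: "prime r" "r dvd h (b ^ i)" for r
  proof -
    obtain p where p: "prime p" "\<sigma> p = r" using \<sigma>_surj [OF r(1)] by blast
    then have "p dvd b ^ i" using \<sigma>(2) [OF p(1), of "b ^ i"] r(2) b by simp
    then have "p = b" using p(1) assms(1) prime_dvd_power primes_dvd_imp_eq by blast
    then show ?thesis using p by simp
  qed
  ultimately show thesis
    using prime_power_if_unique_prime_factor [of "h (b ^ i)" "\<sigma> b"] \<sigma>(1) [OF assms(1)] that by metis
qed

lemma power_closure_h:
  assumes l: "prime l" and b: "prime b" "b \<noteq> l" and x: "x \<ge> 1" "power_closure l b x"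
  shows "power_closure (\<sigma> l) (\<sigma> b) (h x)"
  unfolding power_closure_def
proof
  fix m
  obtain i where "[x = b ^ i] (mod l ^ 1)" using x(2) unfolding power_closure_def by blast
  then have "[x = b ^ i] (mod l)" by simp
  moreover have "\<not> l dvd b ^ i" using l b prime_dvd_power primes_dvd_imp_eq by blast
  ultimately have "\<not> l dvd x" using cong_dvd_iff by blast
  then obtain n where n: "\<And>y. \<lbrakk>y \<ge> 1; [y = x] (mod l ^ n)\<rbrakk> \<Longrightarrow> [h y = h x] (mod \<sigma> l ^ m)"
    using padic_continuous [OF l x(1), of m] by blast
  obtain i where i: "i \<ge> 1" "[x = b ^ i] (mod l ^ n)" using x(2) unfolding power_closure_def by blast
  obtain j where j: "j \<ge> 1" "h (b ^ i) = \<sigma> b ^ j" using h_prime_power [OF b(1) i(1)] by blast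
  have "b ^ i \<ge> 1" using b(1) by (simp add: prime_gt_0_nat Suc_leI)
  then have "[h (b ^ i) = h x] (mod \<sigma> l ^ m)" using n cong_sym [OF i(2)] by blast
  then have "[h x = \<sigma> b ^ j] (mod \<sigma> l ^ m)" unfolding j(2) by (rule cong_sym)
  then show "\<exists>i\<ge>1. [h x = \<sigma> b ^ i] (mod \<sigma> l ^ m)" using j(1) by blast
qed

text \<open>Since \<open>h a\<close> is merely a power of \<open>\<sigma> a\<close>, its membership
  would be too weak; instead \<open>\<sigma> a\<close> is the image of a power of
  \<open>a\<close>.\<close>

lemma power_closure_\<sigma>_imp:
  assumes l: "prime l" and b: "prime b" "b \<noteq> l" and a: "prime a" "power_closure l b a"
  shows "power_closure (\<sigma> l) (\<sigma> b) (\<sigma> a)"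
proof -
  obtain j where j: "j \<ge> 1" "k (\<sigma> a ^ 1) = a ^ j"
    using golomb_homeo.h_prime_power [OF inverse_homeo \<sigma>(1) [OF a(1)] order_refl]
    unfolding \<sigma>_inverse [OF a(1)] by blast
  have "\<sigma> a \<ge> 1" using \<sigma>(1) [OF a(1)] by (simp add: prime_gt_0_nat Suc_leI)
  then have "h (a ^ j) = \<sigma> a" using h_k [of "\<sigma> a"] j(2) by simp
  moreover have "a ^ j \<ge> 1" using a(1) by (simp add: prime_gt_0_nat Suc_leI)
  then have "power_closure (\<sigma> l) (\<sigma> b) (h (a ^ j))"
    by (intro power_closure_h l b power_closure_power a j)
  ultimately show ?thesis by simp
qed

lemma power_closure_\<sigma>:
  assumes "prime l" "prime b" "b \<noteq> l" "prime a"
  shows "power_closure (\<sigma> l) (\<sigma> b) (\<sigma> a) \<longleftrightarrow> power_closure l b a"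
proof
  assume *: "power_closure (\<sigma> l) (\<sigma> b) (\<sigma> a)"
  have "\<sigma> b \<noteq> \<sigma> l" using \<sigma>_inj assms by blast
  then show "power_closure l b a"
    using golomb_homeo.power_closure_\<sigma>_imp [OF inverse_homeo \<sigma>(1) [OF assms(1)] \<sigma>(1) [OF assms(2)] _ \<sigma>(1) [OF assms(4)] *]
    unfolding \<sigma>_inverse [OF assms(1)] \<sigma>_inverse [OF assms(2)] \<sigma>_inverse [OF assms(4)] by blast
qed (use power_closure_\<sigma>_imp assms in blast)

lemma chain_prime_\<sigma>:
  assumes l: "prime l" and b: "chain_prime l b"
  shows "chain_prime (\<sigma> l) (\<sigma> b)"
  unfolding chain_prime_def
proof (intro conjI allI impI)
  have b': "prime b" "b \<noteq> l" using b by (auto simp: chain_prime_def)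
  show "prime (\<sigma> b)" by (rule \<sigma>(1) [OF b'(1)])
  show "\<sigma> b \<noteq> \<sigma> l" using \<sigma>_inj b' l by blast
  fix a c assume ac: "prime a" "prime c" "power_closure (\<sigma> l) (\<sigma> b) a" "power_closure (\<sigma> l) (\<sigma> b) c"
  obtain a' where a': "prime a'" "\<sigma> a' = a" using \<sigma>_surj [OF ac(1)] by blast
  obtain c' where c': "prime c'" "\<sigma> c' = c" using \<sigma>_surj [OF ac(2)] by blast
  have pa: "power_closure l b a'" using power_closure_\<sigma> [OF l b' a'(1)] ac(3) a'(2) by simp
  have pc: "power_closure l b c'" using power_closure_\<sigma> [OF l b' c'(1)] ac(4) c'(2) by simp
  have ne: "y \<noteq> l" if y: "power_closure l b y" for y
  proof
    assume "y = l"
    obtain i where "[y = b ^ i] (mod l ^ 1)" using y unfolding power_closure_def by blast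
    then have "[l = b ^ i] (mod l)" using \<open>y = l\<close> by simp
    then have "l dvd b ^ i" using cong_dvd_iff [of l "b ^ i" l] by simp
    then show False using l b' prime_dvd_power primes_dvd_imp_eq by blast
  qed
  have "power_closure l a' c' \<or> power_closure l c' a'"
    using b pa pc a'(1) c'(1) unfolding chain_prime_def by blast
  then show "power_closure (\<sigma> l) a c \<or> power_closure (\<sigma> l) c a"
    using power_closure_\<sigma> [OF l a'(1) ne [OF pa] c'(1)] power_closure_\<sigma> [OF l c'(1) ne [OF pc] a'(1)] a'(2) c'(2)
    by simp
qed

text \<open>At 2 every odd prime satisfies the chain condition. Were \<open>\<sigma> 2\<close> an
  odd prime \<open>q\<close>, all their images would be 1 modulo \<open>q\<close>, hence in the
  group of one prime of level 1. Pulled back, powers of a single \<open>s\<close> would represent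
  all odd primes modulo 8, where 3 and 5 already conflict.\<close>

lemma \<sigma>_2: "\<sigma> 2 = 2"
proof (rule ccontr)
  define q where "q = \<sigma> 2"
  assume "\<sigma> 2 \<noteq> 2"
  then have q: "prime q" "q \<noteq> 2" using \<sigma>(1) [OF two_is_prime_nat] by (auto simp: q_def)
  then have "odd q" by (rule odd_prime)
  obtain s' where s': "prime s'" "s' \<noteq> q" "level q 1 s'"
    using ex_prime_level [OF q(1), of 1] q(2) by auto
  obtain s where s: "prime s" "\<sigma> s = s'" using \<sigma>_surj [OF s'(1)] by blast
  have "s \<noteq> 2" using s s'(2) q_def by auto
  have closure: "power_closure 2 s b" if b: "prime b" "b \<noteq> 2" for b
  proof -
    have "odd b" using b by (rule odd_prime)
    then have "[b = 1] (mod 2)" by (simp add: Cong.cong_def odd_iff_mod_2_eq_one)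
    then have "chain_prime 2 b" by (rule chain_prime_cong_1 [OF two_is_prime_nat b(1)])
    then have "chain_prime q (\<sigma> b)" unfolding q_def by (rule chain_prime_\<sigma> [OF two_is_prime_nat])
    then have "[\<sigma> b = 1] (mod q ^ 1)"
      using chain_prime_imp_cong_1 [OF q(1) \<open>odd q\<close>] by simp
    then have "power_closure q s' (\<sigma> b)"
      using power_closure_level [OF q(1) _ _ s'(3)] q(2) by simp
    then show ?thesis
      using power_closure_\<sigma> [OF two_is_prime_nat s(1) \<open>s \<noteq> 2\<close> b(1)] by (simp add: s(2) q_def)
  qed
  have "odd s" using s(1) \<open>s \<noteq> 2\<close> by (rule odd_prime)
  have mod8: "[s = b] (mod 8)" if b: "prime b" "b \<noteq> 2" "[b \<noteq> 1] (mod 8)" for b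
  proof -
    obtain i where "[b = s ^ i] (mod 2 ^ 3)" using closure [OF b(1,2)] unfolding power_closure_def by blast
    then have "[b = s ^ i] (mod 8)" by simp
    then have "[b = (if even i then 1 else s)] (mod 8)"
      using odd_power_mod_8 [OF \<open>odd s\<close>, of i] by (rule cong_trans)
    then show ?thesis using b(3) by (cases "even i") (auto simp: cong_sym)
  qed
  have "prime (3::nat)" "prime (5::nat)" by simp_all
  then have "[s = 3] (mod 8)" "[s = 5] (mod 8)" using mod8 [of 3] mod8 [of 5] by (simp_all add: Cong.cong_def)
  then show False by (simp add: Cong.cong_def)
qed

text \<open>Primes of increasing level generate a strictly decreasing chain of closed subgroups, so their
  images have strictly increasing levels; starting from level at least \<open>n\<close>, the levels can only grow.\<close>

lemma h_cong_1_step: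
  assumes l: "prime l" and n: "n \<ge> 1" "l = 2 \<Longrightarrow> n \<ge> 2" "\<sigma> l = 2 \<Longrightarrow> n \<ge> 2"
    and base: "\<And>s. \<lbrakk>prime s; [s = 1] (mod l ^ n)\<rbrakk> \<Longrightarrow> [\<sigma> s = 1] (mod \<sigma> l ^ n)"
    and x: "x \<ge> 1" "[x = 1] (mod l ^ (n + j))"
  shows "[h x = 1] (mod \<sigma> l ^ (n + j))"
proof -
  define q where "q = \<sigma> l"
  have q: "prime q" unfolding q_def by (rule \<sigma>(1) [OF l])
  have lev: "[\<sigma> s = 1] (mod q ^ (n + j))" if "prime s" "s \<noteq> l" "level l (n + j) s" for s j
    using that
  proof (induction j arbitrary: s)
    case 0
    then show ?case using base [of s] by (simp add: level_def q_def)
  next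
    case (Suc j)
    have nj: "0 < n + j" "l = 2 \<Longrightarrow> n + j \<ge> 2" using n by auto
    obtain t where t: "prime t" "t \<noteq> l" "level l (n + j) t" by (rule ex_prime_level [OF l nj])
    have s1: "[s = 1] (mod l ^ (n + Suc j))" using Suc.prems(3) by (simp add: level_def)
    have "power_closure l t s"
      using power_closure_level [OF l nj t(3)] cong_prime_power_le [OF s1, of "n + j"] by simp
    then have ts: "power_closure q (\<sigma> t) (\<sigma> s)"
      unfolding q_def using power_closure_\<sigma> [OF l t(1,2) Suc.prems(1)] by simp
    have "\<not> power_closure l s t"
    proof
      assume "power_closure l s t"
      then have "[t = 1] (mod l ^ (n + Suc j))" using s1 by (rule power_closure_cong_1)
      then show False using t(3) by (simp add: level_def)
    qed
    then have st: "\<not> power_closure q (\<sigma> s) (\<sigma> t)"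
      unfolding q_def using power_closure_\<sigma> [OF l Suc.prems(1,2) t(1)] by simp
    have t1: "[\<sigma> t = 1] (mod q ^ (n + j))" using t by (rule Suc.IH)
    then have "[\<sigma> s = 1] (mod q ^ (n + j))" by (rule power_closure_cong_1 [OF ts])
    moreover have "\<sigma> s > 1" using \<sigma>(1) [OF Suc.prems(1)] prime_gt_1_nat by blast
    ultimately obtain f where f: "f \<ge> n + j" "level q f (\<sigma> s)" using ex_level [OF q] by metis
    have f0: "0 < f" "q = 2 \<Longrightarrow> f \<ge> 2" using f(1) n unfolding q_def by linarith+
    have "f \<noteq> n + j"
    proof
      assume "f = n + j"
      then have "power_closure q (\<sigma> s) (\<sigma> t)"
        using power_closure_level [OF q f0 f(2)] t1 by simp
      with st show False by blast
    qed
    then have "f \<ge> n + Suc j" using f(1) by simp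
    moreover have "[\<sigma> s = 1] (mod q ^ f)" using f(2) by (simp add: level_def)
    ultimately show ?case using cong_prime_power_le by blast
  qed
  have nj: "0 < n + j" "l = 2 \<Longrightarrow> n + j \<ge> 2" using n by auto
  obtain s where s: "prime s" "s \<noteq> l" "level l (n + j) s" by (rule ex_prime_level [OF l nj])
  have "power_closure l s x" using power_closure_level [OF l nj s(3)] x(2) by blast
  then have "power_closure q (\<sigma> s) (h x)"
    unfolding q_def by (rule power_closure_h [OF l s(1,2) x(1)])
  then show ?thesis using lev [OF s] unfolding q_def by (rule power_closure_cong_1)
qed

text \<open>The induction on levels can start at 1: being 1 modulo an odd prime amounts to the chain
  condition, which \<open>\<sigma>\<close> preserves.\<close>

lemma h_cong_1_odd:
  assumes l: "prime l" "l \<noteq> 2" and x: "x \<ge> 1" "j \<ge> 1" "[x = 1] (mod l ^ j)"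
  shows "[h x = 1] (mod \<sigma> l ^ j)"
proof -
  have "\<sigma> l \<noteq> 2" using \<sigma>_inj [OF l(1) two_is_prime_nat] l(2) \<sigma>_2 by simp
  with \<sigma>(1) [OF l(1)] have odd: "odd (\<sigma> l)" by (rule odd_prime)
  have base: "[\<sigma> s = 1] (mod \<sigma> l ^ 1)" if s: "prime s" "[s = 1] (mod l ^ 1)" for s
  proof -
    have "chain_prime l s" using s by (intro chain_prime_cong_1 l) simp_all
    then have "chain_prime (\<sigma> l) (\<sigma> s)" by (rule chain_prime_\<sigma> [OF l(1)])
    then show ?thesis using chain_prime_imp_cong_1 [OF \<sigma>(1) [OF l(1)] odd] by simp
  qed
  obtain i where i: "j = 1 + i" using le_Suc_ex [OF x(2)] by blast
  have "l = 2 \<Longrightarrow> (1::nat) \<ge> 2" "\<sigma> l = 2 \<Longrightarrow> (1::nat) \<ge> 2" using l(2) \<open>\<sigma> l \<noteq> 2\<close> by blast+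
  from h_cong_1_step [OF l(1) order_refl this base x(1) x(3) [unfolded i]]
  show ?thesis unfolding i .
qed

text \<open>The induction starts at 3: a prime that is 1 modulo 8 generates a group strictly inside
  that of 5, which has level 2. The same strict inclusion holds for the images, and by
  \<open>power_closure_2_sym\<close> it is impossible unless the smaller generator is 1 modulo
  8.\<close>

lemma h_cong_1_two:
  assumes x: "x \<ge> 1" "j \<ge> 3" "[x = 1] (mod 2 ^ j)"
  shows "[h x = 1] (mod 2 ^ j)"
proof -
  have five: "prime (5::nat)" "(5::nat) \<noteq> 2" by simp_all
  have lev5: "level 2 2 5" by (simp add: level_def Cong.cong_def)
  have base: "[\<sigma> s = 1] (mod \<sigma> 2 ^ 3)" if s: "prime s" "[s = 1] (mod 2 ^ 3)" for s
  proof -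
    have "s \<noteq> 2" using s(2) by (auto simp: Cong.cong_def)
    have "[s = 1] (mod 2 ^ 2)" using cong_prime_power_le [OF s(2), of 2] by simp
    then have "power_closure 2 5 s" using power_closure_level [OF two_is_prime_nat _ _ lev5] by simp
    then have 1: "power_closure 2 (\<sigma> 5) (\<sigma> s)"
      using power_closure_\<sigma> [OF two_is_prime_nat five s(1)] by (simp add: \<sigma>_2)
    have "\<not> power_closure 2 s 5"
      using power_closure_cong_1 [OF _ s(2), of 5] by (auto simp: Cong.cong_def)
    then have 2: "\<not> power_closure 2 (\<sigma> s) (\<sigma> 5)"
      using power_closure_\<sigma> [OF two_is_prime_nat s(1) \<open>s \<noteq> 2\<close> five(1)] by (simp add: \<sigma>_2)
    have "\<sigma> 5 \<noteq> 2" using \<sigma>_inj [OF five(1) two_is_prime_nat] \<sigma>_2 by simp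
    with \<sigma>(1) [OF five(1)] have "odd (\<sigma> 5)" by (rule odd_prime)
    then have "[\<sigma> s = 1] (mod 8)" using power_closure_2_sym [OF _ 1] 2 by blast
    then show ?thesis by (simp add: \<sigma>_2)
  qed
  obtain i where i: "j = 3 + i" using le_Suc_ex [OF x(2)] by blast
  have "(3::nat) \<ge> 1" "(2::nat) = 2 \<Longrightarrow> (3::nat) \<ge> 2" "\<sigma> 2 = 2 \<Longrightarrow> (3::nat) \<ge> 2" by simp_all
  from h_cong_1_step [OF two_is_prime_nat this base x(1) x(3) [unfolded i]]
  show ?thesis unfolding i \<sigma>_2 .
qed

section \<open>Prime powers dividing \<open>x - 1\<close>\<close>

lemma h_cong_1_odd_iff:
  assumes l: "prime l" "l \<noteq> 2" and x: "x \<ge> 1" "j \<ge> 1"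
  shows "[h x = 1] (mod \<sigma> l ^ j) \<longleftrightarrow> [x = 1] (mod l ^ j)"
proof
  assume *: "[h x = 1] (mod \<sigma> l ^ j)"
  have "\<sigma> l \<noteq> 2" using \<sigma>_inj [OF l(1) two_is_prime_nat] l(2) \<sigma>_2 by simp
  then show "[x = 1] (mod l ^ j)"
    using golomb_homeo.h_cong_1_odd [OF inverse_homeo \<sigma>(1) [OF l(1)] _ h_pos [OF x(1)] x(2) *]
    unfolding \<sigma>_inverse [OF l(1)] k_h [OF x(1)] by blast
qed (rule h_cong_1_odd [OF l x])

lemma h_cong_1_two_imp: "x \<ge> 1 \<Longrightarrow> j \<ge> 3 \<Longrightarrow> [h x = 1] (mod 2 ^ j) \<Longrightarrow> [x = 1] (mod 2 ^ j)"
  using golomb_homeo.h_cong_1_two [OF inverse_homeo h_pos, of x j] k_h [of x] by simp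

lemma even_h: "x \<ge> 1 \<Longrightarrow> even (h x) \<longleftrightarrow> even x"
  using \<sigma>(2) [OF two_is_prime_nat, of x] by (simp only: \<sigma>_2)

lemma odd_prime_power_dvd_pred:
  assumes x: "x \<ge> 1" and r: "prime r" "r \<noteq> 2" "j \<ge> 1" "r ^ j dvd h x - 1"
  obtains l where "prime l" "\<sigma> l = r" "l ^ j dvd x - 1"
proof -
  obtain l where l: "prime l" "\<sigma> l = r" using \<sigma>_surj [OF r(1)] by blast
  have "l \<noteq> 2" using l(2) r(2) \<sigma>_2 by auto
  have "[h x = 1] (mod \<sigma> l ^ j)" using r(4) cong_1_iff_dvd [OF h_pos [OF x]] l(2) by simp
  then have "[x = 1] (mod l ^ j)" using h_cong_1_odd_iff [OF l(1) \<open>l \<noteq> 2\<close> x r(3)] by simp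
  then show thesis using that [OF l] cong_1_iff_dvd [OF x] by simp
qed

text \<open>The factor 2 is lost because the levels 1 and 2 at the prime 2 are not distinguished by
  the chains of closed subgroups.\<close>

lemma pred_dvd:
  assumes x: "x \<ge> 2" and fixed: "\<And>y. 1 \<le> y \<Longrightarrow> y < x \<Longrightarrow> h y = y"
  shows "h x - 1 dvd 2 * (x - 1)"
proof (rule dvd_if_prime_powers_dvd)
  have x1: "x \<ge> 1" using x by simp
  have "h x \<noteq> h 1" using h_inj [of x 1] x by simp
  then show "h x - 1 > 0" using h_pos [OF x1] unfolding h_1 by linarith
  fix r j :: nat assume r: "prime r" "j \<ge> 1" "r ^ j dvd h x - 1"
  show "r ^ j dvd 2 * (x - 1)"
  proof (cases "r = 2")
    case False
    obtain l where l: "prime l" "\<sigma> l = r" "l ^ j dvd x - 1"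
      using odd_prime_power_dvd_pred [OF x1 r(1) False r(2,3)] by blast
    have "l dvd l ^ j" using r(2) by (simp add: dvd_power)
    then have "l dvd x - 1" using l(3) dvd_trans by blast
    then have "l < x" using x dvd_imp_le [of l "x - 1"] by simp
    moreover have "l \<ge> 1" using l(1) by (simp add: prime_gt_0_nat Suc_leI)
    ultimately have "\<sigma> l = l" using l(1) fixed by (intro \<sigma>_fixed) auto
    then show ?thesis using l by simp
  next
    case True
    consider "j = 1" | "j = 2" | "j \<ge> 3" using r(2) by linarith
    then show ?thesis
    proof cases
      case 1
      then show ?thesis using True by simp
    next
      case 2
      \<comment> \<open>Only parity is under control here: \<open>x - 1\<close> is even, and the
        extra factor 2 completes 4.\<close>
      have "2 dvd h x - 1" using r(3) True 2 dvd_trans [of 2 "2 ^ 2" "h x - 1"] by simp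
      then have "odd (h x)" using h_pos [OF x1] by (cases "h x") auto
      then have "2 dvd x - 1" using even_h [OF x1] by simp
      then have "2 * 2 dvd 2 * (x - 1)" by (rule mult_dvd_mono [OF dvd_refl])
      then show ?thesis using 2 True by (simp add: power2_eq_square)
    next
      case 3
      have "[h x = 1] (mod 2 ^ j)" using r(3) True cong_1_iff_dvd [OF h_pos [OF x1]] by simp
      then have "[x = 1] (mod 2 ^ j)" by (rule h_cong_1_two_imp [OF x1 3])
      then show ?thesis using True cong_1_iff_dvd [OF x1] by simp
    qed
  qed
qed

text \<open>Smaller values are already taken, so \<open>h x \<ge> x\<close>, and
  \<open>pred_dvd\<close> leaves only \<open>x\<close> and \<open>2 * x - 1\<close>. The latter is
  coprime to \<open>x\<close>; this forces \<open>x\<close> to be a prime that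
  \<open>\<sigma>\<close> sends to the prime \<open>2 * x - 1\<close>, which is refuted at the
  neighbour \<open>x + 1\<close>.\<close>

theorem h_eq_self: "x \<ge> 1 \<Longrightarrow> h x = x"
proof (induction x rule: less_induct)
  case (less x)
  have fixed: "h y = y" if "1 \<le> y" "y < x" for y using less.IH [OF that(2,1)] .
  show ?case
  proof (cases "x = 1")
    case True
    then show ?thesis using h_1 by simp
  next
    case False
    then have x2: "x \<ge> 2" using less.prems by simp
    define y where "y = h x"
    have y1: "y \<ge> 1" unfolding y_def by (rule h_pos [OF less.prems])
    have "y \<ge> x"
    proof (rule ccontr)
      assume "\<not> y \<ge> x"
      then have "h y = h x" using fixed y1 by (simp add: y_def)
      then have "y = x" using h_inj [OF y1 less.prems] by blast
      with \<open>\<not> y \<ge> x\<close> show False by simp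
    qed
    obtain c where c: "2 * (x - 1) = (y - 1) * c"
      using pred_dvd [OF x2 fixed] unfolding y_def by blast
    have "c \<noteq> 0" using c x2 by (intro notI) simp
    have "c < 3"
    proof (rule ccontr)
      assume "\<not> c < 3"
      then have "(y - 1) * c \<ge> (x - 1) * 3" using \<open>y \<ge> x\<close> by (intro mult_mono) auto
      then show False using c x2 by linarith
    qed
    show ?thesis
    proof (cases "c = 2")
      case True
      then show ?thesis using c y1 less.prems by (simp add: y_def)
    next
      case False
      then have "c = 1" using \<open>c \<noteq> 0\<close> \<open>c < 3\<close> by linarith
      then have y: "y = 2 * x - 1" using c y1 x2 by simp
      have small: "\<sigma> p = p" if "prime p" "p < x" for p
        using that fixed by (intro \<sigma>_fixed) (auto simp: prime_gt_0_nat Suc_leI)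
      have \<sigma>_dvd: "\<sigma> p dvd y" if "prime p" "p dvd x" for p
        using \<sigma>(2) [OF that(1) less.prems] that(2) by (simp add: y_def)
      have coprime: "\<not> p dvd x \<or> \<not> p dvd y" if "prime p" for p
      proof (rule ccontr)
        assume "\<not> (\<not> p dvd x \<or> \<not> p dvd y)"
        then have "p dvd 2 * x - y" by (intro dvd_diff_nat) auto
        moreover have "2 * x - y = 1" using y x2 by simp
        ultimately show False using that by (simp add: prime_nat_iff)
      qed
      \<comment> \<open>A prime factor below \<open>x\<close> is fixed by \<open>\<sigma>\<close>
        and would divide both \<open>x\<close> and \<open>2 * x - 1\<close>.\<close>
      have x: "prime x"
      proof -
        have "x \<noteq> 1" using x2 by simp
        then obtain p where p: "prime p" "p dvd x" using prime_factor_nat by blast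
        have "\<not> p < x"
        proof
          assume "p < x"
          then have "p dvd y" using \<sigma>_dvd [OF p] small [OF p(1)] by simp
          then show False using coprime [OF p(1)] p(2) by blast
        qed
        then have "p = x" using dvd_imp_le [OF p(2)] x2 by simp
        then show ?thesis using p(1) by simp
      qed
      have "x \<noteq> 2"
      proof
        assume "x = 2"
        then have "2 dvd y" using \<sigma>_dvd [OF two_is_prime_nat] \<sigma>_2 by simp
        then show False using \<open>x = 2\<close> y by simp
      qed
      with x have "odd x" by (rule odd_prime)
      define r where "r = \<sigma> x"
      have r: "prime r" "r dvd y" using \<sigma>(1) [OF x] \<sigma>_dvd [OF x] by (simp_all add: r_def)
      have "\<not> r < x"
      proof
        assume "r < x"
        then have "\<sigma> r = \<sigma> x" using small [OF r(1)] by (simp add: r_def)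
        then have "r = x" using \<sigma>_inj [OF r(1) x] by blast
        with \<open>r < x\<close> show False by simp
      qed
      moreover have "r \<noteq> x" using coprime [OF x] r(2) by auto
      ultimately have "r > x" by simp
      obtain d where d: "y = r * d" using r(2) by blast
      have "d < 2"
      proof (rule ccontr)
        assume "\<not> d < 2"
        then have "r * d \<ge> r * 2" by (intro mult_left_mono) auto
        then show False using d y \<open>r > x\<close> by linarith
      qed
      moreover have "d \<noteq> 0" using d y1 by (intro notI) simp
      ultimately have ry: "r = y" using d by (cases d) auto
      have r2: "r \<noteq> 2" using \<open>r > x\<close> x2 by simp
      \<comment> \<open>As \<open>x + 1\<close> exceeds 1 by the odd prime \<open>x\<close>, the odd
        prime powers dividing \<open>z - 1\<close> are known, and \<open>z\<close> is even, so the
        ambiguity at 2 disappears: \<open>z - 1\<close> must be \<open>r\<close>.\<close>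
      define z where "z = h (x + 1)"
      have z1: "z \<ge> 1" unfolding z_def by (intro h_pos) simp
      have "[x + 1 = 1] (mod x ^ 1)" using cong_1_iff_dvd [of "x + 1" "x ^ 1"] by simp
      then have "[z = 1] (mod r ^ 1)"
        unfolding z_def r_def by (intro h_cong_1_odd x \<open>x \<noteq> 2\<close>) simp_all
      then have rz: "r dvd z - 1" using cong_1_iff_dvd [OF z1] by simp
      have "even z" unfolding z_def using even_h [of "x + 1"] \<open>odd x\<close> by simp
      then have odd_z: "odd (z - 1)" using z1 by simp
      have "z - 1 dvd r"
      proof (rule dvd_if_prime_powers_dvd)
        show "z - 1 > 0" using odd_z by (cases "z - 1") auto
        fix t j :: nat assume t: "prime t" "j \<ge> 1" "t ^ j dvd z - 1"
        have "t \<noteq> 2"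
        proof
          assume "t = 2"
          moreover have "t dvd t ^ j" using t(2) by (simp add: dvd_power)
          ultimately have "2 dvd z - 1" using t(3) dvd_trans by blast
          then show False using odd_z by blast
        qed
        have x1: "x + 1 \<ge> 1" by simp
        obtain l where "prime l" "\<sigma> l = t" "l ^ j dvd x + 1 - 1"
          by (rule odd_prime_power_dvd_pred [OF x1 t(1) \<open>t \<noteq> 2\<close> t(2) t(3) [unfolded z_def]])
        then have l: "prime l" "\<sigma> l = t" "l ^ j dvd x" by simp_all
        have "l dvd l ^ j" using t(2) by (simp add: dvd_power)
        then have "l dvd x" using l(3) dvd_trans by blast
        then have "l = x" using l(1) x primes_dvd_imp_eq by blast
        then have "x ^ j \<le> x ^ 1" using l(3) x2 dvd_imp_le [of "x ^ j" x] by simp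
        moreover have "1 < x" using x2 by simp
        ultimately have "j \<le> 1" using power_le_imp_le_exp by blast
        then have "j = 1" using t(2) by simp
        then show "t ^ j dvd r" using l(2) \<open>l = x\<close> by (simp add: r_def)
      qed
      then have "z - 1 = r" using rz by (rule dvd_antisym)
      then have "z = 2 * x" using ry y z1 x2 by simp
      then have xz: "x dvd z" by simp
      \<comment> \<open>The prime sent to \<open>x\<close> divides \<open>x + 1\<close> and is not
        below \<open>x\<close>, so it would be the even number \<open>x + 1\<close>.\<close>
      obtain p where p: "prime p" "\<sigma> p = x" using \<sigma>_surj [OF x] by blast
      then have px: "p dvd x + 1" using \<sigma>(2) [OF p(1), of "x + 1"] xz by (simp add: z_def)
      then have "p \<le> x + 1" by (intro dvd_imp_le) auto
      moreover have "\<not> p < x" using small [OF p(1)] p(2) by auto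
      moreover have "p \<noteq> x"
      proof
        assume "p = x"
        then have "x dvd (x + 1) - x" using px by (intro dvd_diff_nat) simp_all
        then show False using x2 by simp
      qed
      ultimately have "p = x + 1" by simp
      then have "even p" using \<open>odd x\<close> by simp
      then have "p = 2" using odd_prime [OF p(1)] by blast
      then show ?thesis using \<open>p = x + 1\<close> x2 by simp
    qed
  qed
qed

end

theorem theorem1p1:
  fixes h :: "nat \<Rightarrow> nat"
  assumes "homeomorphic_map golomb_topology golomb_topology h"
  shows "\<forall>x \<in> topspace golomb_topology. h x = x"
proof
  obtain k where "homeomorphic_maps golomb_topology golomb_topology h k"
    using assms homeomorphic_map_maps by blast
  then interpret golomb_homeo h k by unfold_locales
  fix x assume "x \<in> topspace golomb_topology"
  then show "h x = x" using h_eq_self by (simp add: topspace_golomb)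
qed

end
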